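(* Let $1 \leq p \leq \infty$, and let $D \colon H(\mathbb{C}) \to H(\mathbb{C})$, $Df = f'$, be the differentiation operator on the Fréchet space $H(\mathbb{C})$ of entire functions. (i) Let $a = 1/(2\max\{2,p\})$ (so $a=0$ if $p=\infty$). For any function $\varphi \colon \mathbb{R}_+ \to \mathbb{R}_+$ with $\varphi(r) \to \infty$ as $r \to \infty$, there exists a $D$-distributionally irregular entire function $f$ with $$M_p(f,r) \leq \varphi(r)\frac{e^r}{r^a}$$ for all $r>0$ sufficiently large. (ii) Let $a = 1/(2\min\{2,p\})$. There does not exist a $D$-distributionally irregular entire function $f$ for which there is a constant $c>0$ such that $$M_p(f,r) \leq c\,\frac{e^r}{r^a}$$ for all $r>0$ sufficiently large.
   Context: $H(\mathbb{C})$ is the Fréchet space of entire functions on $\mathbb{C}$ with the topology of uniform convergence on compact sets, defined for instance by the increasing sequence of seminorms $\|f\|_k = \sup_{|z|\leq k}|f(z)|$, $k\in\mathbb{N}$. For $f \in H(\mathbb{C})$ and $r>0$: $M_p(f,r) = \left(\frac{1}{2\pi}\int_0^{2\pi}|f(re^{it})|^p\,dt\right)^{1/p}$ for $1\leq p<\infty$, and $M_\infty(f,r) = \sup_{|z|=r}|f(z)|$. The upper density of $A\subset\mathbb{N}$ is $\overline{\mathrm{dens}}(A) = \limsup_{n\to\infty}\frac{|A\cap\{1,\dots,n\}|}{n}$. Let $X$ be a Fréchet space whose topology is given by an increasing sequence of seminorms $(\|\cdot\|_k)_{k\in\mathbb{N}}$ and $T\colon X\to X$ a continuous linear operator. A vector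 $x\in X$ is distributionally irregular for $T$ ($T$-distributionally irregular) if both: (1) there is $A\subset\mathbb{N}$ with $\overline{\mathrm{dens}}(A)=1$ such that $T^n x\to 0$ as $n\to\infty$ with $n\in A$ (the orbit is distributionally near to 0); and (2) there are $m\in\mathbb{N}$ and $B\subset\mathbb{N}$ with $\overline{\mathrm{dens}}(B)=1$ such that $\|T^n x\|_m\to\infty$ as $n\to\infty$ with $n\in B$ (the orbit is distributionally unbounded). *)

theory Defs
  imports "HOL-Complex_Analysis.Complex_Analysis" "HOL-Library.Extended_Real"
begin

definition upper_density :: "nat set \<Rightarrow> ereal" where
  "upper_density A = limsup (\<lambda>n. ereal (real (card (A \<inter> {1..n})) / real n))"

text \<open>
  The Frechet space enters through its increasing sequence \<open>s\<close> of defining seminorms, so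
  convergence to 0 means that every seminorm tends to 0. The filter
  \<open>inf sequentially (principal A)\<close> is ``\<open>n\<close> tends to infinity with \<open>n \<in> A\<close>''; it is nontrivial
  because a set of upper density 1 is infinite.
\<close>

definition distributionally_near_zero ::
    "(nat \<Rightarrow> 'a \<Rightarrow> real) \<Rightarrow> ('a \<Rightarrow> 'a) \<Rightarrow> 'a \<Rightarrow> bool" where
  "distributionally_near_zero s T x \<longleftrightarrow>
     (\<exists>A. upper_density A = 1 \<and>
          (\<forall>k. ((\<lambda>n. s k ((T ^^ n) x)) \<longlongrightarrow> 0) (inf sequentially (principal A))))"

definition distributionally_unbounded ::
    "(nat \<Rightarrow> 'a \<Rightarrow> real) \<Rightarrow> ('a \<Rightarrow> 'a) \<Rightarrow> 'a \<Rightarrow> bool" where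
  "distributionally_unbounded s T x \<longleftrightarrow>
     (\<exists>m B. upper_density B = 1 \<and>
          filterlim (\<lambda>n. s m ((T ^^ n) x)) at_top (inf sequentially (principal B)))"

definition distributionally_irregular ::
    "(nat \<Rightarrow> 'a \<Rightarrow> real) \<Rightarrow> ('a \<Rightarrow> 'a) \<Rightarrow> 'a \<Rightarrow> bool" where
  "distributionally_irregular s T x \<longleftrightarrow>
     distributionally_near_zero s T x \<and> distributionally_unbounded s T x"

definition entire_seminorm :: "nat \<Rightarrow> (complex \<Rightarrow> complex) \<Rightarrow> real" where
  "entire_seminorm k f = (SUP z\<in>cball 0 (real k). norm (f z))"

text \<open>On entire functions these seminorms induce uniform convergence on compact sets.\<close>

lemma entire_seminorms_tendsto_0_iff:
  fixes F :: "'i filter" and f :: "'i \<Rightarrow> complex \<Rightarrow> complex"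
  assumes "\<And>i. f i holomorphic_on UNIV"
  shows "(\<forall>k. ((\<lambda>i. entire_seminorm k (f i)) \<longlongrightarrow> 0) F) \<longleftrightarrow>
         (\<forall>K. compact K \<longrightarrow> uniform_limit K f (\<lambda>_. 0) F)"
proof -
  have bdd: "bdd_above ((\<lambda>z. norm (f i z)) ` cball 0 (real k))" for i k
  proof -
    have "continuous_on (cball 0 (real k)) (\<lambda>z. norm (f i z))"
      using holomorphic_on_imp_continuous_on[OF holomorphic_on_subset[OF assms subset_UNIV]]
      by (rule continuous_on_norm)
    from bounded_imp_bdd_above[OF compact_imp_bounded[OF compact_continuous_image[OF this compact_cball]]]
    show ?thesis .
  qed
  have le: "norm (f i z) \<le> entire_seminorm k (f i)" if "z \<in> cball 0 (real k)" for i k z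
    unfolding entire_seminorm_def using cSUP_upper[OF that bdd] .
  have nonneg: "0 \<le> entire_seminorm k (f i)" for i k
    by (rule order_trans[OF norm_ge_zero le[of 0]]) simp
  show ?thesis
  proof (intro iffI allI impI)
    fix K :: "complex set"
    assume *: "\<forall>k. ((\<lambda>i. entire_seminorm k (f i)) \<longlongrightarrow> 0) F" and "compact K"
    then obtain b where b: "\<And>z. z \<in> K \<Longrightarrow> norm z \<le> b"
      using compact_imp_bounded[of K] unfolding bounded_iff by blast
    obtain k where k: "b \<le> real k" using real_arch_simple by blast
    show "uniform_limit K f (\<lambda>_. 0) F"
    proof (rule uniform_limitI)
      fix e :: real assume "e > 0"
      then have "\<forall>\<^sub>F i in F. entire_seminorm k (f i) < e"
        using order_tendstoD(2)[OF spec[OF *]] by simp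
      then show "\<forall>\<^sub>F i in F. \<forall>z\<in>K. dist (f i z) 0 < e"
      proof eventually_elim
        case (elim i)
        show ?case
        proof
          fix z assume "z \<in> K"
          then have "z \<in> cball 0 (real k)" using b[of z] k by simp
          from le[OF this, of i] elim show "dist (f i z) 0 < e" by simp
        qed
      qed
    qed
  next
    fix k
    assume "\<forall>K. compact K \<longrightarrow> uniform_limit K f (\<lambda>_. 0) F"
    then have u: "uniform_limit (cball 0 (real k)) f (\<lambda>_. 0) F" by simp
    show "((\<lambda>i. entire_seminorm k (f i)) \<longlongrightarrow> 0) F"
    proof (rule tendstoI)
      fix e :: real assume "e > 0"
      then have "\<forall>\<^sub>F i in F. \<forall>z\<in>cball 0 (real k). dist (f i z) 0 < e / 2"
        using uniform_limitD[OF u, of "e / 2"] by simp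
      then show "\<forall>\<^sub>F i in F. dist (entire_seminorm k (f i)) 0 < e"
      proof eventually_elim
        case (elim i)
        have "entire_seminorm k (f i) \<le> e / 2"
          unfolding entire_seminorm_def
        proof (rule cSUP_least)
          fix z :: complex assume "z \<in> cball 0 (real k)"
          with elim have "dist (f i z) 0 < e / 2" by blast
          then show "norm (f i z) \<le> e / 2" by simp
        qed simp
        then show ?case using nonneg[of k i] \<open>e > 0\<close> by (simp add: dist_real_def)
      qed
    qed
  qed
qed

definition M_mean :: "ereal \<Rightarrow> (complex \<Rightarrow> complex) \<Rightarrow> real \<Rightarrow> real" where
  "M_mean p f r =
     (if p = \<infinity> then (SUP z\<in>sphere 0 r. norm (f z))
      else let q = real_of_ereal p in
        (1 / (2 * pi) * integral {0..2 * pi}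
          (\<lambda>t. norm (f (of_real r * exp (\<i> * of_real t))) powr q)) powr (1 / q))"

end

(*
  Write b_n = f^(n)(0), so that f(z) = sum b_n z^n / n!. By Stirling, the Poisson weights
  r^n / n! are at most of size e^r / sqrt r, and they have that size for |n - r| <= C sqrt r.

  (ii) Truncate f on the circle of radius r at height e^r (this matters for p < 2 only). The
  bounded part is controlled in L^2, hence by Bessel's inequality, and the remainder in L^1,
  hence in every Taylor coefficient. With r = k^2 this gives sum |b_n|^2 = O(k) over
  k^2 <= n < (k+1)^2. So the |b_n|, and with them the seminorms of the n-th derivatives, have
  bounded Cesaro means, which excludes divergence to infinity along a set of upper density 1.

  (i) Let b_n vanish on every other one of rapidly growing blocks [N_(j-1), N_j) of indices and
  equal j on the remaining ones. Since j grows at most logarithmically in n, the maximum modulus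
  is O(j e^r) and the mean square is O(j^2 e^(2r) / sqrt r) for r in the j-th block; M_p
  interpolates between the two, and j is below any prescribed multiple of phi if the N_j grow
  fast enough.
*)
theory Submission
  imports Defs
begin

section \<open>Fourier coefficients on circles\<close>

text \<open>For p <= 2 the exponent 1/(2p) says that the integral of |f|^p over the circle is
  O(e^(pr) / sqrt r). At the height e^r both pieces of the truncation are usable: the bounded part
  has square integral at most e^((2-p)r) times this, so O(e^(2r) / sqrt r), just as for p >= 2; each
  coefficient of the remainder is O(e^r / sqrt r), which over O(sqrt r) indices again contributes
  O(e^(2r) / sqrt r). The obstacle in (i) is that the n-th derivative sees the coefficients of all
  later blocks. Hence only those n are used that lie in the first half of a block: the coefficients
  n, ..., 2n - 1 then belong to the same block, and the later ones carry a factor 1/k! with k >= n.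
  Later blocks are harmless for the growth too: an index n that lies i + 1 blocks beyond r satisfies
  n >= 2^i r, so its level exceeds that of r by at most n / r, and the first two Poisson moments
  suffice.\<close>

lemma has_integral_cis:
  fixes k :: int
  shows "((\<lambda>t. cis (of_int k * t)) has_integral (if k = 0 then 2 * of_real pi else 0)) {0..2 * pi}"
proof (cases "k = 0")
  case True
  then show ?thesis
    using has_integral_const_real[of "1::complex" 0 "2*pi"] by (simp add: scaleR_conv_of_real)
next
  case False
  have "((\<lambda>t. cis (of_int k * t)) has_integral
      cis (of_int k * (2 * pi)) / (\<i> * of_int k) - cis (of_int k * 0) / (\<i> * of_int k)) {0..2 * pi}"
  proof (rule fundamental_theorem_of_calculus)
    fix t :: real
    show "((\<lambda>t. cis (of_int k * t) / (\<i> * of_int k)) has_vector_derivative cis (of_int k * t))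
        (at t within {0..2 * pi})"
    proof -
      have "((\<lambda>z. exp (\<i> * (of_int k * z)) / (\<i> * of_int k)) has_field_derivative
          exp (\<i> * (of_int k * of_real t))) (at (of_real t))"
        using False by (auto intro!: derivative_eq_intros simp: mult_ac)
      from has_vector_derivative_real_field[OF this] show ?thesis
        by (simp add: cis_conv_exp)
    qed
  qed simp
  moreover have "cis (of_int k * (2 * pi)) = 1"
    using cis_multiple_2pi[of "of_int k"] by (simp add: mult_ac)
  ultimately show ?thesis using False by simp
qed

lemma has_integral_norm_trig_poly:
  fixes c :: "nat \<Rightarrow> complex"
  assumes "finite W"
  shows "((\<lambda>t. (norm (\<Sum>n\<in>W. c n * cis (real n * t)))\<^sup>2) has_integral
      2 * pi * (\<Sum>n\<in>W. (norm (c n))\<^sup>2)) {0..2 * pi}"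
proof -
  have "((\<lambda>t. \<Sum>n\<in>W. \<Sum>m\<in>W. c n * cnj (c m) * cis (of_int (int n - int m) * t)) has_integral
     (\<Sum>n\<in>W. \<Sum>m\<in>W. c n * cnj (c m) * (if int n - int m = 0 then 2 * of_real pi else 0)))
      {0..2 * pi}"
    by (intro has_integral_sum assms has_integral_mult_right has_integral_cis)
  moreover have "(\<Sum>n\<in>W. \<Sum>m\<in>W. c n * cnj (c m) * cis (of_int (int n - int m) * t))
      = of_real ((norm (\<Sum>n\<in>W. c n * cis (real n * t)))\<^sup>2)" for t
  proof -
    have "(\<Sum>n\<in>W. \<Sum>m\<in>W. c n * cnj (c m) * cis (of_int (int n - int m) * t))
      = (\<Sum>n\<in>W. \<Sum>m\<in>W. (c n * cis (real n * t)) * cnj (c m * cis (real m * t)))"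
      by (intro sum.cong refl) (simp add: cis_mult cis_cnj algebra_simps)
    also have "\<dots> = (\<Sum>n\<in>W. c n * cis (real n * t)) * cnj (\<Sum>n\<in>W. c n * cis (real n * t))"
      by (simp only: sum_product cnj_sum)
    finally show ?thesis by (simp only: complex_norm_square)
  qed
  moreover have "(\<Sum>n\<in>W. \<Sum>m\<in>W. c n * cnj (c m) * (if int n - int m = 0 then 2 * of_real pi else 0))
     = of_real (2 * pi * (\<Sum>n\<in>W. (norm (c n))\<^sup>2))"
  proof -
    have "(\<Sum>m\<in>W. c n * cnj (c m) * (if int n - int m = 0 then 2 * of_real pi else 0))
       = of_real (2 * pi * (norm (c n))\<^sup>2)" if "n \<in> W" for n
    proof -
      have "(\<Sum>m\<in>W. c n * cnj (c m) * (if int n - int m = 0 then 2 * of_real pi else 0))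
        = (\<Sum>m\<in>W. if m = n then c n * cnj (c n) * (2 * of_real pi) else 0)"
        by (intro sum.cong) auto
      then show ?thesis
        using that assms by (simp add: complex_norm_square del: of_real_power)
    qed
    then show ?thesis by (simp add: sum_distrib_left)
  qed
  ultimately have "((\<lambda>t. complex_of_real ((norm (\<Sum>n\<in>W. c n * cis (real n * t)))\<^sup>2)) has_integral
     of_real (2 * pi * (\<Sum>n\<in>W. (norm (c n))\<^sup>2))) {0..2 * pi}"
    by simp
  from has_integral_linear[OF this bounded_linear_Re] show ?thesis by (simp add: o_def)
qed

lemma Bessel_inequality:
  fixes G :: "real \<Rightarrow> complex" and c :: "nat \<Rightarrow> complex"
  assumes G: "continuous_on {0..2 * pi} G" and W: "finite W"
    and c: "\<And>n. n \<in> W \<Longrightarrow> ((\<lambda>t. G t * cis (- (real n * t))) has_integral 2 * of_real pi * c n) {0..2 * pi}"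
  shows "2 * pi * (\<Sum>n\<in>W. (norm (c n))\<^sup>2) \<le> integral {0..2 * pi} (\<lambda>t. (norm (G t))\<^sup>2)"
proof -
  define P where "P t = (\<Sum>n\<in>W. c n * cis (real n * t))" for t
  let ?S = "\<Sum>n\<in>W. (norm (c n))\<^sup>2"
  have i1: "((\<lambda>t. (norm (G t))\<^sup>2) has_integral integral {0..2 * pi} (\<lambda>t. (norm (G t))\<^sup>2)) {0..2 * pi}"
    by (intro integrable_integral integrable_continuous_real continuous_intros G)
  have i2: "((\<lambda>t. (norm (P t))\<^sup>2) has_integral 2 * pi * ?S) {0..2 * pi}"
    unfolding P_def by (rule has_integral_norm_trig_poly[OF W])
  have "((\<lambda>t. \<Sum>n\<in>W. cnj (c n) * (G t * cis (- (real n * t)))) has_integral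
      (\<Sum>n\<in>W. cnj (c n) * (2 * of_real pi * c n))) {0..2 * pi}"
    by (intro has_integral_sum W has_integral_mult_right c)
  moreover have "(\<Sum>n\<in>W. cnj (c n) * (2 * of_real pi * c n)) = of_real (2 * pi * ?S)"
    by (simp add: sum_distrib_left complex_norm_square mult_ac del: of_real_power)
  moreover have "(\<Sum>n\<in>W. cnj (c n) * (G t * cis (- (real n * t)))) = G t * cnj (P t)" for t
    by (simp add: P_def sum_distrib_left cis_cnj mult_ac)
  ultimately have "((\<lambda>t. G t * cnj (P t)) has_integral of_real (2 * pi * ?S)) {0..2 * pi}"
    by simp
  from has_integral_linear[OF this bounded_linear_Re]
  have i3: "((\<lambda>t. Re (G t * cnj (P t))) has_integral 2 * pi * ?S) {0..2 * pi}"
    by (simp add: o_def)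
  have "(norm (G t - P t))\<^sup>2 = (norm (G t))\<^sup>2 - 2 * Re (G t * cnj (P t)) + (norm (P t))\<^sup>2" for t
    unfolding cmod_power2 by (simp add: power2_eq_square algebra_simps)
  then have "((\<lambda>t. (norm (G t - P t))\<^sup>2) has_integral
      integral {0..2 * pi} (\<lambda>t. (norm (G t))\<^sup>2) - 2 * (2 * pi * ?S) + 2 * pi * ?S) {0..2 * pi}"
    using has_integral_add[OF has_integral_diff[OF i1 has_integral_mult_right[OF i3, of 2]] i2] by simp
  then have "0 \<le> integral {0..2 * pi} (\<lambda>t. (norm (G t))\<^sup>2) - 2 * (2 * pi * ?S) + 2 * pi * ?S"
    by (rule has_integral_nonneg) simp
  then show ?thesis by simp
qed

text \<open>Cauchy's formula for higher derivatives, parametrized by the angle and multiplied by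
  \<open>r ^ n / \<i>\<close>.\<close>

lemma has_integral_Taylor_coeff:
  fixes f :: "complex \<Rightarrow> complex"
  assumes f: "f holomorphic_on UNIV" and r: "r > 0"
  shows "((\<lambda>t. f (of_real r * cis t) * cis (- (real n * t))) has_integral
      2 * of_real pi * ((deriv ^^ n) f 0 / fact n * of_real r ^ n)) {0..2 * pi}"
proof -
  have "((\<lambda>u. f u / (u - 0) ^ Suc n) has_contour_integral
      (of_real (2 * pi) * \<i> / fact n * (deriv ^^ n) f 0)) (circlepath 0 r)"
    by (rule Cauchy_has_contour_integral_higher_derivative_circlepath)
       (use f r in \<open>auto intro: holomorphic_on_imp_continuous_on holomorphic_on_subset\<close>)
  then have "((\<lambda>t. f (0 + of_real r * cis t) / (0 + of_real r * cis t - 0) ^ Suc n * of_real r * \<i> * cis t)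
      has_integral (2 * of_real pi * \<i> / fact n * (deriv ^^ n) f 0)) {0..2 * pi}"
    unfolding circlepath_def using has_contour_integral_part_circlepath_iff[of 0 "2*pi"] by simp
  from has_integral_mult_right[OF this, of "of_real r ^ n / \<i>"]
  have "((\<lambda>t. of_real r ^ n / \<i> * (f (of_real r * cis t) / (of_real r * cis t) ^ Suc n * of_real r * \<i> * cis t))
      has_integral 2 * of_real pi * ((deriv ^^ n) f 0 / fact n * of_real r ^ n)) {0..2 * pi}"
    by (simp add: field_simps)
  moreover have "of_real r ^ n / \<i> * (f (of_real r * cis t) / (of_real r * cis t) ^ Suc n * of_real r * \<i> * cis t)
     = f (of_real r * cis t) * cis (- (real n * t))" for t
  proof -
    have "cis (- (real n * t)) = inverse (cis (real n * t))"
      by simp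
    also have "\<dots> = inverse (cis t ^ n)"
      by (simp only: Complex.DeMoivre)
    finally have "cis (- (real n * t)) = inverse (cis t ^ n)" .
    then show ?thesis using r by (simp add: field_simps power_mult_distrib)
  qed
  ultimately show ?thesis by simp
qed

section \<open>Comparison of L^q and L^2 means; truncation\<close>

text \<open>Below \<open>l\<close> the first summand dominates, above \<open>l\<close> the second,
  because \<open>s - t \<le> 0\<close>. Integrated at a suitable height \<open>l\<close>, this
  replaces the power mean inequality at the cost of a factor 2. It is used in both directions, from
  q to 2 and from 2 to q.\<close>

lemma powr_le_split:
  fixes x l s t :: real
  assumes "0 \<le> x" "0 < l" "0 < s" "s \<le> t"
  shows "x powr s \<le> l powr s + l powr (s - t) * x powr t"
proof (cases "x \<le> l")
  case True
  then have "x powr s \<le> l powr s"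
    using assms by (intro powr_mono2) auto
  then show ?thesis by (simp add: add_increasing2)
next
  case False
  have "x powr s = x powr (s - t) * x powr t"
    using False assms by (simp flip: powr_add)
  also have "\<dots> \<le> l powr (s - t) * x powr t"
    using False assms by (intro mult_right_mono powr_mono2') auto
  finally show ?thesis by (simp add: add_increasing)
qed

lemma continuous_on_circle:
  fixes f :: "complex \<Rightarrow> complex"
  assumes "f holomorphic_on UNIV"
  shows "continuous_on S (\<lambda>t. f (of_real r * cis t))"
  unfolding cis_conv_exp
  by (rule continuous_on_compose2[OF holomorphic_on_imp_continuous_on[OF assms]])
     (auto intro!: continuous_intros)

lemma continuous_on_norm_powr:
  fixes G :: "'a::topological_space \<Rightarrow> 'b::real_normed_vector" and q :: real
  assumes "continuous_on S G" "q > 0"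
  shows "continuous_on S (\<lambda>t. norm (G t) powr q)"
  using assms by (intro continuous_on_powr' continuous_intros) auto

lemma M_mean_ereal:
  "M_mean (ereal q) f r =
    (1 / (2 * pi) * integral {0..2 * pi} (\<lambda>t. norm (f (of_real r * cis t)) powr q)) powr (1 / q)"
  by (simp add: M_mean_def cis_conv_exp)

lemma integral_powr_le_M_mean:
  assumes f: "f holomorphic_on UNIV" and q: "q > 0" and M: "M_mean (ereal q) f r \<le> l"
  shows "integral {0..2 * pi} (\<lambda>t. norm (f (of_real r * cis t)) powr q) \<le> 2 * pi * l powr q"
proof -
  define I where "I = integral {0..2 * pi} (\<lambda>t. norm (f (of_real r * cis t)) powr q)"
  have I: "I \<ge> 0"
    unfolding I_def
    by (intro integral_nonneg integrable_continuous_real continuous_on_norm_powr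
        continuous_on_circle f q) auto
  have "1 / (2 * pi) * I = ((1 / (2 * pi) * I) powr (1 / q)) powr q"
    using I q by (simp add: powr_powr)
  also have "\<dots> \<le> l powr q"
    using M q by (intro powr_mono2) (auto simp: M_mean_ereal I_def)
  finally show ?thesis unfolding I_def[symmetric] by (simp add: field_simps)
qed

lemma norm_le_M_mean_infinity:
  assumes f: "f holomorphic_on UNIV" and z: "norm z = r"
  shows "norm (f z) \<le> M_mean \<infinity> f r"
proof -
  have "continuous_on (sphere 0 r) (\<lambda>z. norm (f z))"
    using f by (intro continuous_on_norm holomorphic_on_imp_continuous_on)
       (rule holomorphic_on_subset, auto)
  then have "bdd_above ((\<lambda>z. norm (f z)) ` sphere 0 r)"
    by (intro bounded_imp_bdd_above compact_imp_bounded compact_continuous_image compact_sphere)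
  then show ?thesis
    using z by (auto simp: M_mean_def intro!: cSUP_upper)
qed

lemma integral_norm_square_le_M_mean:
  assumes f: "f holomorphic_on UNIV" and p: "2 \<le> p" and r: "0 \<le> r"
    and M: "M_mean p f r \<le> l" and l: "l > 0"
  shows "integral {0..2 * pi} (\<lambda>t. (norm (f (of_real r * cis t)))\<^sup>2) \<le> 4 * pi * l\<^sup>2"
proof (cases p)
  case (real q)
  define N where "N t = norm (f (of_real r * cis t))" for t
  have cont: "continuous_on {0..2 * pi} N"
    unfolding N_def by (intro continuous_on_norm continuous_on_circle f)
  have q: "2 \<le> q" using p real by simp
  have cq: "continuous_on {0..2 * pi} (\<lambda>t. N t powr q)"
    unfolding N_def using q by (intro continuous_on_norm_powr continuous_on_circle f) auto
  have bd: "(N t)\<^sup>2 \<le> l powr 2 + l powr (2 - q) * N t powr q" for t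
  proof -
    have N0: "N t \<ge> 0" by (simp add: N_def)
    have "N t powr 2 \<le> l powr 2 + l powr (2 - q) * N t powr q"
      \<comment> \<open>Split at the height \<open>l\<close> of the mean itself: both summands then
        integrate to at most \<open>2 * pi * l powr 2\<close>, whence the constant
        \<open>4 * pi\<close>.\<close>
      using powr_le_split[of "N t" l 2 q] q l N0 by simp
    then show ?thesis using N0 by simp
  qed
  have "integral {0..2 * pi} (\<lambda>t. (N t)\<^sup>2)
      \<le> integral {0..2 * pi} (\<lambda>t. l powr 2 + l powr (2 - q) * N t powr q)"
    by (intro integral_le integrable_continuous_real continuous_intros cont cq bd)
  also have "\<dots> = 2 * pi * l powr 2 + l powr (2 - q) * integral {0..2 * pi} (\<lambda>t. N t powr q)"
    by (subst Henstock_Kurzweil_Integration.integral_add)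
       (auto intro!: integrable_continuous_real continuous_intros cq)
  also have "\<dots> \<le> 2 * pi * l powr 2 + l powr (2 - q) * (2 * pi * l powr q)"
    unfolding N_def using q M real
    by (intro add_left_mono mult_left_mono integral_powr_le_M_mean f) auto
  also have "l powr (2 - q) * (2 * pi * l powr q) = 2 * pi * l powr 2"
    using l by (simp add: powr_diff)
  finally show ?thesis using l by (simp add: N_def)
next
  case PInf
  have "integral {0..2 * pi} (\<lambda>t. (norm (f (of_real r * cis t)))\<^sup>2) \<le> integral {0..2 * pi} (\<lambda>t. l\<^sup>2)"
  proof (intro integral_le integrable_continuous_real continuous_intros continuous_on_circle f)
    fix t
    have "norm (f (of_real r * cis t)) \<le> M_mean p f r"
      unfolding PInf using r by (intro norm_le_M_mean_infinity f) (simp add: norm_mult)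
    then show "(norm (f (of_real r * cis t)))\<^sup>2 \<le> l\<^sup>2"
      using M by (intro power_mono) auto
  qed
  also have "\<dots> = 2 * pi * l\<^sup>2" by simp
  also have "\<dots> \<le> 4 * pi * l\<^sup>2" by (intro mult_right_mono) auto
  finally show ?thesis .
qed (use p in auto)

text \<open>The radial projection onto the disc of radius \<open>l\<close>. The denominator
  \<open>max l (norm w)\<close> stays away from 0, so continuity needs no case distinction at
  \<open>w = 0\<close>.\<close>

definition truncate_at :: "real \<Rightarrow> complex \<Rightarrow> complex" where
  "truncate_at l w = of_real (l / max l (norm w)) * w"

lemma continuous_on_truncate_at:
  assumes "l > 0" "continuous_on S G"
  shows "continuous_on S (\<lambda>t. truncate_at l (G t))"
  unfolding truncate_at_def using assms by (auto intro!: continuous_intros)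

text \<open>The norm on the left is the minimum of \<open>l\<close> and \<open>norm w\<close>; one
  part of the square is bounded by a power of each.\<close>

lemma norm_truncate_at_square_le:
  assumes l: "l > 0" and q: "1 \<le> q" "q \<le> 2"
  shows "(norm (truncate_at l w))\<^sup>2 \<le> l powr (2 - q) * norm w powr q"
proof (cases "norm w \<le> l")
  case True
  show ?thesis
  proof (cases "w = 0")
    case False
    have "(norm (truncate_at l w))\<^sup>2 = norm w powr (2 - q) * norm w powr q"
      using True False l by (simp add: truncate_at_def max_def flip: powr_add)
    also have "\<dots> \<le> l powr (2 - q) * norm w powr q"
      using True q by (intro mult_right_mono powr_mono2) auto
    finally show ?thesis .
  qed (simp add: truncate_at_def)
next
  case False
  with l have "w \<noteq> 0" by auto
  with False have "norm (truncate_at l w) = l"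
    using l by (simp add: truncate_at_def max_def norm_mult norm_divide)
  then have "(norm (truncate_at l w))\<^sup>2 = l powr (2 - q) * l powr q"
    using l by (simp flip: powr_add)
  also have "\<dots> \<le> l powr (2 - q) * norm w powr q"
    using False q l by (intro mult_left_mono powr_mono2) auto
  finally show ?thesis .
qed

text \<open>The difference vanishes unless \<open>norm w > l\<close>; then it is at most
  \<open>norm w\<close>, and the nonpositive power \<open>1 - q\<close> of \<open>norm w\<close> is
  at most that of \<open>l\<close>.\<close>

lemma norm_minus_truncate_at_le:
  assumes l: "l > 0" and q: "1 \<le> q"
  shows "norm (w - truncate_at l w) \<le> l powr (1 - q) * norm w powr q"
proof (cases "norm w \<le> l")
  case True
  then show ?thesis using l by (simp add: truncate_at_def max_def)
next
  case False
  have "w - truncate_at l w = of_real (1 - l / norm w) * w"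
    using False by (simp add: truncate_at_def max_def algebra_simps)
  then have "norm (w - truncate_at l w) = \<bar>1 - l / norm w\<bar> * norm w"
    by (simp only: norm_mult norm_of_real)
  also have "\<bar>1 - l / norm w\<bar> = 1 - l / norm w"
    using False l by (intro abs_of_nonneg) (auto simp: divide_le_eq)
  also have "(1 - l / norm w) * norm w \<le> 1 * norm w"
    using l by (intro mult_right_mono) auto
  also have "\<dots> = norm w powr (1 - q) * norm w powr q"
    using False l by (simp flip: powr_add)
  also have "\<dots> \<le> l powr (1 - q) * norm w powr q"
    using False q l by (intro mult_right_mono powr_mono2') auto
  finally show ?thesis .
qed

lemma sum_Taylor_square_le_of_two_le:
  assumes f: "f holomorphic_on UNIV" and p: "2 \<le> p" and c: "c > 0" and r: "r \<ge> 1"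
    and M: "M_mean p f r \<le> c * (exp r / r powr (1 / 4))" and W: "finite W"
  shows "(\<Sum>n\<in>W. (norm ((deriv ^^ n) f 0 / fact n * of_real r ^ n))\<^sup>2) \<le> 2 * c\<^sup>2 * (exp r)\<^sup>2 / sqrt r"
proof -
  let ?l = "c * (exp r / r powr (1 / 4))"
  have "2 * pi * (\<Sum>n\<in>W. (norm ((deriv ^^ n) f 0 / fact n * of_real r ^ n))\<^sup>2)
      \<le> integral {0..2 * pi} (\<lambda>t. (norm (f (of_real r * cis t)))\<^sup>2)"
    using r by (intro Bessel_inequality W continuous_on_circle has_integral_Taylor_coeff f) auto
  also have "\<dots> \<le> 4 * pi * ?l\<^sup>2"
    using r c by (intro integral_norm_square_le_M_mean[OF f p _ M]) auto
  also have "(r powr (1 / 4))\<^sup>2 = sqrt r"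
    using r by (simp add: powr_half_sqrt power2_eq_square flip: powr_add)
  then have "?l\<^sup>2 = c\<^sup>2 * (exp r)\<^sup>2 / sqrt r"
    by (simp add: power_mult_distrib power_divide)
  finally have "2 * pi * (\<Sum>n\<in>W. (norm ((deriv ^^ n) f 0 / fact n * of_real r ^ n))\<^sup>2)
      \<le> 2 * pi * (2 * c\<^sup>2 * (exp r)\<^sup>2 / sqrt r)"
    by simp
  then show ?thesis by (subst (asm) mult_le_cancel_left_pos) auto
qed

text \<open>The coefficients split as \<open>g n + h n\<close> along the truncation
  \<open>F = G + H\<close>. Bessel bounds the \<open>g n\<close> jointly; the \<open>h n\<close>
  have only the individual bound coming from the L^1 norm of \<open>H\<close>, so their contribution
  is multiplied by the size of \<open>W\<close>.\<close>

lemma sum_Taylor_square_le_of_le_two: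
  assumes f: "f holomorphic_on UNIV" and q: "1 \<le> q" "q \<le> 2" and c: "c > 0" and r: "r \<ge> 1"
    and M: "M_mean (ereal q) f r \<le> c * (exp r / r powr (1 / (2 * q)))"
    and W: "finite W" and card: "real (card W) \<le> 3 * sqrt r"
  shows "(\<Sum>n\<in>W. (norm ((deriv ^^ n) f 0 / fact n * of_real r ^ n))\<^sup>2)
    \<le> (2 * c powr q + 6 * (c powr q)\<^sup>2) * (exp r)\<^sup>2 / sqrt r"
proof -
  define a where "a n = (deriv ^^ n) f 0 / fact n * of_real r ^ n" for n
  define F where "F t = f (of_real r * cis t)" for t
  define G where "G t = truncate_at (exp r) (F t)" for t
  define H where "H t = F t - G t" for t
  define C where "C = c powr q"
  have contF: "continuous_on S F" for S
    unfolding F_def by (rule continuous_on_circle[OF f])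
  have contG: "continuous_on S G" for S
    unfolding G_def by (intro continuous_on_truncate_at contF) simp
  have contH: "continuous_on S H" for S
    unfolding H_def by (intro continuous_intros contF contG)
  have contFq: "continuous_on S (\<lambda>t. norm (F t) powr q)" for S
    using q by (intro continuous_on_norm_powr contF) auto
  have cis_cont: "continuous_on S (\<lambda>t. cis (- (real n * t)))" for S n
    by (intro continuous_intros)
  have "integral {0..2 * pi} (\<lambda>t. norm (F t) powr q) \<le> 2 * pi * (c * (exp r / r powr (1 / (2 * q)))) powr q"
    unfolding F_def using q by (intro integral_powr_le_M_mean f M) auto
  \<comment> \<open>The exponent 1/(2q) turns into \<open>sqrt r\<close> for every
    \<open>q\<close>.\<close>
  also have "(c * (exp r / r powr (1 / (2 * q)))) powr q = C * (exp r powr q / sqrt r)"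
    using c r q by (simp add: C_def powr_mult powr_divide powr_powr powr_half_sqrt)
  finally have IF: "integral {0..2 * pi} (\<lambda>t. norm (F t) powr q) \<le> 2 * pi * (C * (exp r powr q / sqrt r))" .

  define g where "g n = integral {0..2 * pi} (\<lambda>t. G t * cis (- (real n * t))) / (2 * of_real pi)" for n
  define h where "h n = integral {0..2 * pi} (\<lambda>t. H t * cis (- (real n * t))) / (2 * of_real pi)" for n
  have gI: "((\<lambda>t. G t * cis (- (real n * t))) has_integral 2 * of_real pi * g n) {0..2 * pi}" for n
    unfolding g_def using integrable_integral[OF integrable_continuous_real[OF continuous_on_mult[OF contG cis_cont]]]
    by simp
  have hI: "((\<lambda>t. H t * cis (- (real n * t))) has_integral 2 * of_real pi * h n) {0..2 * pi}" for n
    unfolding h_def using integrable_integral[OF integrable_continuous_real[OF continuous_on_mult[OF contH cis_cont]]]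
    by simp
  have "((\<lambda>t. F t * cis (- (real n * t))) has_integral 2 * of_real pi * g n + 2 * of_real pi * h n) {0..2 * pi}" for n
    using has_integral_add[OF gI[of n] hI[of n]] by (simp add: H_def flip: distrib_right)
  moreover have "((\<lambda>t. F t * cis (- (real n * t))) has_integral 2 * of_real pi * a n) {0..2 * pi}" for n
    unfolding F_def a_def using r by (intro has_integral_Taylor_coeff f) auto
  ultimately have "2 * of_real pi * a n = 2 * of_real pi * g n + 2 * of_real pi * h n" for n
    by (rule has_integral_unique[rotated])
  then have "2 * of_real pi * a n = 2 * of_real pi * (g n + h n)" for n
    by (simp only: distrib_left)
  then have a_eq: "a n = g n + h n" for n
    by simp

  have "2 * pi * (\<Sum>n\<in>W. (norm (g n))\<^sup>2) \<le> integral {0..2 * pi} (\<lambda>t. (norm (G t))\<^sup>2)"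
    by (intro Bessel_inequality contG W gI)
  also have "\<dots> \<le> integral {0..2 * pi} (\<lambda>t. exp r powr (2 - q) * norm (F t) powr q)"
    unfolding G_def using q
    by (intro integral_le integrable_continuous_real continuous_intros contFq contG[unfolded G_def]
          norm_truncate_at_square_le) auto
  also have "\<dots> = exp r powr (2 - q) * integral {0..2 * pi} (\<lambda>t. norm (F t) powr q)"
    by simp
  also have "\<dots> \<le> exp r powr (2 - q) * (2 * pi * (C * (exp r powr q / sqrt r)))"
    by (intro mult_left_mono IF) auto
  also have "\<dots> = 2 * pi * (C * (exp r)\<^sup>2 / sqrt r)"
    by (simp add: powr_diff)
  finally have gsum: "(\<Sum>n\<in>W. (norm (g n))\<^sup>2) \<le> C * (exp r)\<^sup>2 / sqrt r"
    by (subst (asm) mult_le_cancel_left_pos) auto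

  have hbd: "norm (h n) \<le> C * exp r / sqrt r" for n
  proof -
    have "norm (integral {0..2 * pi} (\<lambda>t. H t * cis (- (real n * t))))
        \<le> integral {0..2 * pi} (\<lambda>t. exp r powr (1 - q) * norm (F t) powr q)"
    proof (rule integral_norm_bound_integral)
      show "(\<lambda>t. H t * cis (- (real n * t))) integrable_on {0..2 * pi}"
        using hI by blast
      show "(\<lambda>t. exp r powr (1 - q) * norm (F t) powr q) integrable_on {0..2 * pi}"
        by (intro integrable_continuous_real continuous_intros contFq)
      fix t
      show "norm (H t * cis (- (real n * t))) \<le> exp r powr (1 - q) * norm (F t) powr q"
        using norm_minus_truncate_at_le[of "exp r" q "F t"] q by (simp add: H_def G_def norm_mult)
    qed
    also have "\<dots> = exp r powr (1 - q) * integral {0..2 * pi} (\<lambda>t. norm (F t) powr q)"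
      by simp
    also have "\<dots> \<le> exp r powr (1 - q) * (2 * pi * (C * (exp r powr q / sqrt r)))"
      by (intro mult_left_mono IF) auto
    also have "\<dots> = 2 * pi * (C * exp r / sqrt r)"
      by (simp add: powr_diff)
    finally show ?thesis
      by (simp add: h_def norm_divide norm_mult field_simps)
  qed

  have "(\<Sum>n\<in>W. (norm (a n))\<^sup>2) \<le> (\<Sum>n\<in>W. 2 * (norm (g n))\<^sup>2 + 2 * (C * exp r / sqrt r)\<^sup>2)"
  proof (rule sum_mono)
    fix n
    have "(norm (a n))\<^sup>2 \<le> (norm (g n) + norm (h n))\<^sup>2"
      unfolding a_eq by (intro power_mono norm_triangle_ineq) auto
    also have "\<dots> \<le> 2 * (norm (g n))\<^sup>2 + 2 * (norm (h n))\<^sup>2"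
      using sum_squares_ge_zero[of "norm (g n) - norm (h n)" 0]
      by (simp add: power2_eq_square algebra_simps)
    also have "(norm (h n))\<^sup>2 \<le> (C * exp r / sqrt r)\<^sup>2"
      by (intro power_mono hbd) auto
    finally show "(norm (a n))\<^sup>2 \<le> 2 * (norm (g n))\<^sup>2 + 2 * (C * exp r / sqrt r)\<^sup>2"
      by simp
  qed
  also have "\<dots> = 2 * (\<Sum>n\<in>W. (norm (g n))\<^sup>2) + real (card W) * (2 * (C * exp r / sqrt r)\<^sup>2)"
    by (simp add: sum.distrib sum_distrib_left)
  also have "\<dots> \<le> 2 * (C * (exp r)\<^sup>2 / sqrt r) + 3 * sqrt r * (2 * (C * exp r / sqrt r)\<^sup>2)"
    by (intro add_mono mult_left_mono gsum mult_right_mono card) auto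
  \<comment> \<open>The size of the window restores one factor \<open>sqrt r\<close> out of the two
    lost by squaring.\<close>
  also have "3 * sqrt r * (2 * (C * exp r / sqrt r)\<^sup>2) = 6 * C\<^sup>2 * (exp r)\<^sup>2 / sqrt r"
    using r by (simp add: power2_eq_square field_simps)
  also have "2 * (C * (exp r)\<^sup>2 / sqrt r) + 6 * C\<^sup>2 * (exp r)\<^sup>2 / sqrt r
      = (2 * C + 6 * C\<^sup>2) * (exp r)\<^sup>2 / sqrt r"
    by (simp add: add_divide_distrib distrib_right)
  finally show ?thesis by (simp add: a_def C_def)
qed

text \<open>Common form of both ranges of \<open>p\<close>; the point is that \<open>K\<close>
  depends neither on \<open>r\<close> nor on \<open>W\<close>.\<close>

lemma sum_Taylor_square_le:
  fixes p :: ereal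
  assumes f: "f holomorphic_on UNIV" and p: "1 \<le> p" and c: "c > 0"
  obtains K where "K > 0"
    "\<And>r W. r \<ge> 1 \<Longrightarrow> M_mean p f r \<le> c * (exp r / r powr real_of_ereal (1 / (2 * min 2 p))) \<Longrightarrow>
       finite W \<Longrightarrow> real (card W) \<le> 3 * sqrt r \<Longrightarrow>
       (\<Sum>n\<in>W. (norm ((deriv ^^ n) f 0 / fact n * of_real r ^ n))\<^sup>2) \<le> K * (exp r)\<^sup>2 / sqrt r"
proof (cases "2 \<le> p")
  case True
  then have a: "real_of_ereal (1 / (2 * min 2 p)) = 1 / 4"
    unfolding min_absorb1[OF True] by (simp add: one_ereal_def)
  show ?thesis
    by (rule that[of "2 * c\<^sup>2"], use c in simp, unfold a)
       (rule sum_Taylor_square_le_of_two_le[OF f True c])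
next
  case False
  then obtain q where q: "p = ereal q" "1 \<le> q" "q \<le> 2"
    using p by (cases p) auto
  then have a: "real_of_ereal (1 / (2 * min 2 p)) = 1 / (2 * q)"
    using False by (simp add: min_def one_ereal_def)
  have pos: "2 * c powr q + 6 * (c powr q)\<^sup>2 > 0"
    using c by (simp add: add_pos_nonneg)
  show ?thesis
    by (rule that[OF pos], unfold a, unfold q(1))
       (rule sum_Taylor_square_le_of_le_two[OF f q(2,3) c])
qed

section \<open>Stirling bounds and Poisson weights\<close>

text \<open>The sequence \<open>d\<close> decreases from 1, whereas \<open>d - 1 / (4 * n)\<close>
  increases from 3/4. Both monotonicities compare \<open>ln (m + 1) - ln m\<close>, the integral of
  the convex function 1/x, with a quadrature rule.\<close>

lemma ln_Stirling_bounds: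
  fixes n :: nat
  assumes "n \<ge> 1"
  defines "d \<equiv> ln (fact n) + real n - (real n + 1 / 2) * ln (real n)"
  shows "d \<le> 1" "3 / 4 + 1 / (4 * real n) \<le> d"
proof -
  define e where "e m = ln (fact m) + real m - (real m + 1 / 2) * ln (real m)" for m :: nat
  have step: "e m - e (Suc m) = (real m + 1 / 2) * (ln (real (Suc m)) - ln (real m)) - 1" if "m \<ge> 1" for m
  proof -
    have "ln (fact (Suc m)) = ln (real (Suc m)) + ln (fact m)"
      by (simp add: ln_mult del: of_nat_Suc)
    then show ?thesis by (simp add: e_def algebra_simps)
  qed
  have "e n \<le> 1 \<and> 3 / 4 + 1 / (4 * real n) \<le> e n"
    using assms(1)
  proof (induction n rule: nat_induct_at_least)
    case base
    show ?case by (simp add: e_def)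
  next
    case (Suc m)
    \<comment> \<open>Midpoint rule: a lower bound for the integral of 1/x.\<close>
    have "1 = (real m + 1 / 2) * (2 * (real (Suc m) - real m) / (real m + real (Suc m)))"
      by (simp add: field_simps)
    also have "\<dots> \<le> (real m + 1 / 2) * (ln (real (Suc m)) - ln (real m))"
      using Suc by (intro mult_left_mono ln_inverse_approx_ge) auto
    finally have "e (Suc m) \<le> e m"
      using step[of m] Suc by simp
    \<comment> \<open>Trapezoidal rule: an upper bound, with an error that telescopes.\<close>
    moreover have "(real m + 1 / 2) * (ln (real (Suc m)) - ln (real m))
        \<le> (real m + 1 / 2) * (1 * (inverse (real m) + inverse (real m + 1)) / 2)"
      using Suc ln_inverse_approx_le[of "real m" 1] by (intro mult_left_mono) (auto simp: add.commute)
    moreover have "(real m + 1 / 2) * (1 * (inverse (real m) + inverse (real m + 1)) / 2)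
        = 1 + 1 / (4 * real m) - 1 / (4 * real (Suc m))"
      using Suc by (simp add: divide_simps) (simp add: algebra_simps)
    ultimately show ?case
      using step[OF Suc.hyps] Suc.IH by linarith
  qed
  then show "d \<le> 1" "3 / 4 + 1 / (4 * real n) \<le> d"
    by (simp_all add: d_def e_def)
qed

lemma exp_ln_Stirling:
  assumes "n \<ge> 1"
  shows "exp ((real n + 1 / 2) * ln (real n)) = sqrt (real n) * real n ^ n"
proof -
  have "exp ((real n + 1 / 2) * ln (real n)) = real n powr (real n + 1 / 2)"
    using assms by (simp add: powr_def)
  then show ?thesis
    using assms by (simp add: powr_add powr_realpow powr_half_sqrt)
qed

lemma Stirling_upper:
  assumes "n \<ge> 1"
  shows "fact n * exp (real n) \<le> exp 1 * (sqrt (real n) * real n ^ n)"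
proof -
  have "fact n * exp (real n) = exp (ln (fact n) + real n)"
    by (simp add: exp_add)
  also have "\<dots> \<le> exp (1 + (real n + 1 / 2) * ln (real n))"
    using ln_Stirling_bounds(1)[OF assms] by simp
  finally show ?thesis
    by (simp only: exp_add exp_ln_Stirling[OF assms])
qed

lemma Stirling_lower:
  assumes "n \<ge> 1"
  shows "sqrt (real n) * real n ^ n \<le> fact n * exp (real n)"
proof -
  have "0 \<le> 3 / 4 + 1 / (4 * real n)" by simp
  then have "exp ((real n + 1 / 2) * ln (real n)) \<le> exp (ln (fact n) + real n)"
    using ln_Stirling_bounds(2)[OF assms] by (simp only: exp_le_cancel_iff)
  also have "\<dots> = fact n * exp (real n)"
    by (simp add: exp_add)
  finally show ?thesis
    by (simp only: exp_ln_Stirling[OF assms])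
qed

text \<open>Gaussian decay to the right of the mode: passing from \<open>j\<close> to
  \<open>j + 1\<close> multiplies the weight by \<open>1 / (1 + x)\<close> with
  \<open>x = (j + 1) / m\<close>, which is at least \<open>exp (- x)\<close>, and these exponents
  add up to \<open>j * (j + 1) / (2 * m)\<close>.\<close>

lemma power_over_fact_shift_ge:
  fixes m j :: nat
  assumes m: "m \<ge> 1"
  shows "exp (- (real j * (real j + 1) / (2 * real m))) * (real m ^ m / fact m)
    \<le> real m ^ (m + j) / fact (m + j)"
proof (induction j)
  case (Suc j)
  let ?x = "(real j + 1) / real m"
  have "(1 + ?x) * exp (- ?x) \<le> exp ?x * exp (- ?x)"
    by (intro mult_right_mono exp_ge_add_one_self) auto
  then have "exp (- ?x) \<le> 1 / (1 + ?x)"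
    using m by (simp add: field_simps flip: exp_add)
  also have "\<dots> = real m / real (m + j + 1)"
    using m by (simp add: field_simps)
  finally have le: "exp (- ?x) \<le> real m / real (m + j + 1)" .
  have "- (real (Suc j) * (real (Suc j) + 1) / (2 * real m))
      = - ?x + - (real j * (real j + 1) / (2 * real m))"
    using m by (simp add: field_simps)
  then have "exp (- (real (Suc j) * (real (Suc j) + 1) / (2 * real m))) * (real m ^ m / fact m)
     = exp (- ?x) * (exp (- (real j * (real j + 1) / (2 * real m))) * (real m ^ m / fact m))"
    by (simp only: exp_add mult.assoc)
  also have "\<dots> \<le> real m / real (m + j + 1) * (real m ^ (m + j) / fact (m + j))"
    by (intro mult_mono le Suc.IH) auto
  also have "\<dots> = real m ^ (m + Suc j) / fact (m + Suc j)"
    by simp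
  finally show ?case .
qed simp

lemma power_over_fact_ge:
  fixes k n :: nat
  assumes k: "k \<ge> 1" and n: "k\<^sup>2 \<le> n" "n \<le> k\<^sup>2 + 2 * k"
  shows "exp (- 4) * exp (real (k\<^sup>2)) / real k \<le> real (k\<^sup>2) ^ n / fact n"
proof -
  define m where "m = k\<^sup>2"
  define j where "j = n - m"
  have m: "m \<ge> 1" and j: "n = m + j" "j \<le> 2 * k"
    using k n by (auto simp: m_def j_def)
  have sq: "sqrt (real m) = real k" by (simp add: m_def)
  \<comment> \<open>A shift by at most \<open>2 * k\<close>, about two standard deviations, costs
    \<open>exp (- 3)\<close>; the other factor \<open>exp (- 1)\<close> comes from Stirling.\<close>
  have "real j * (real j + 1) \<le> (2 * real k) * (3 * real k)"
    using j(2) k by (intro mult_mono) auto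
  also have "\<dots> = 3 * (2 * real m)" by (simp add: m_def power2_eq_square)
  finally have "real j * (real j + 1) / (2 * real m) \<le> 3"
    using m by (simp add: divide_le_eq)
  then have e3: "exp (- 3) \<le> exp (- (real j * (real j + 1) / (2 * real m)))"
    by simp
  have "exp (real m) / (exp 1 * real k) \<le> real m ^ m / fact m"
    using Stirling_upper[OF m] k by (simp add: sq field_simps)
  then have "exp (- 3) * (exp (real m) / (exp 1 * real k))
     \<le> exp (- (real j * (real j + 1) / (2 * real m))) * (real m ^ m / fact m)"
    by (intro mult_mono e3) auto
  also have "\<dots> \<le> real m ^ n / fact n"
    unfolding j(1) by (rule power_over_fact_shift_ge[OF m])
  also have "exp (- 3) * (exp (real m) / (exp 1 * real k)) = exp (- 3) * exp (- 1) * exp (real m) / real k"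
    by (simp add: exp_minus field_simps)
  also have "exp (- 3) * exp (- 1) = exp (- 4 :: real)"
    by (simp flip: exp_add)
  finally show ?thesis by (simp add: m_def)
qed

text \<open>The windows from \<open>k\<^sup>2\<close> to \<open>(k + 1)\<^sup>2\<close> tile the
  indices, and each is so short that all Poisson weights at the radius \<open>k\<^sup>2\<close> are
  comparable to the largest one. Dividing by these weights turns the bound on Taylor terms into one
  on derivatives at 0.\<close>

lemma sum_derivs_le:
  fixes f :: "complex \<Rightarrow> complex"
  assumes f: "f holomorphic_on UNIV" and p: "1 \<le> p" and c: "c > 0"
    and M: "\<forall>\<^sub>F r in at_top. M_mean p f r \<le> c * (exp r / r powr real_of_ereal (1 / (2 * min 2 p)))"
  obtains E where "\<And>N. (\<Sum>n<N. norm ((deriv ^^ n) f 0)) \<le> E * (real N + 1)"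
proof -
  define b where "b n = norm ((deriv ^^ n) f 0)" for n
  obtain K where K: "K > 0"
    "\<And>r W. r \<ge> 1 \<Longrightarrow> M_mean p f r \<le> c * (exp r / r powr real_of_ereal (1 / (2 * min 2 p))) \<Longrightarrow>
       finite W \<Longrightarrow> real (card W) \<le> 3 * sqrt r \<Longrightarrow>
       (\<Sum>n\<in>W. (norm ((deriv ^^ n) f 0 / fact n * of_real r ^ n))\<^sup>2) \<le> K * (exp r)\<^sup>2 / sqrt r"
    using sum_Taylor_square_le[OF f p c] by blast
  obtain R where R: "\<And>r. r \<ge> R \<Longrightarrow> M_mean p f r \<le> c * (exp r / r powr real_of_ereal (1 / (2 * min 2 p)))"
    using M unfolding eventually_at_top_linorder by blast
  obtain k1 :: nat where k1: "R \<le> real k1" using real_arch_simple by blast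
  define k0 where "k0 = max 1 k1"
  \<comment> \<open>The 8 compensates the square of the factor \<open>exp (- 4)\<close> from
    \<open>power_over_fact_ge\<close>.\<close>
  define K' where "K' = K * exp 8"
  have K': "K' > 0" using K(1) by (simp add: K'_def)
  have block: "(\<Sum>n\<in>{k\<^sup>2..<(Suc k)\<^sup>2}. (b n)\<^sup>2) \<le> K' * real k" if "k \<ge> k0" for k
  proof -
    let ?W = "{k\<^sup>2..<(Suc k)\<^sup>2}" and ?r = "real (k\<^sup>2)"
    have k: "k \<ge> 1" and "k1 \<le> k" using that by (auto simp: k0_def)
    then have "R \<le> real k" using k1 by simp
    also have "real k \<le> ?r" using k by (simp add: power2_eq_square)
    finally have rR: "R \<le> ?r" .
    have r1: "?r \<ge> 1" using k by simp
    have "(Suc k)\<^sup>2 - k\<^sup>2 = 2 * k + 1" by (simp add: power2_eq_square)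
    \<comment> \<open>\<open>2 * k + 1 \<le> 3 * k\<close>, and \<open>k\<close> is the root of the
      radius.\<close>
    then have "real (card ?W) \<le> 3 * sqrt ?r" using k by simp
    then have "(\<Sum>n\<in>?W. (norm ((deriv ^^ n) f 0 / fact n * of_real ?r ^ n))\<^sup>2) \<le> K * (exp ?r)\<^sup>2 / sqrt ?r"
      by (intro K(2) r1 R rR) auto
    moreover have "(\<Sum>n\<in>?W. (b n)\<^sup>2 * (exp (- 4) * exp ?r / real k)\<^sup>2)
      \<le> (\<Sum>n\<in>?W. (norm ((deriv ^^ n) f 0 / fact n * of_real ?r ^ n))\<^sup>2)"
    proof (rule sum_mono)
      fix n assume "n \<in> ?W"
      then have "exp (- 4) * exp ?r / real k \<le> ?r ^ n / fact n"
        using k by (intro power_over_fact_ge) (auto simp: power2_eq_square)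
      then have "(b n * (exp (- 4) * exp ?r / real k))\<^sup>2 \<le> (b n * (?r ^ n / fact n))\<^sup>2"
        by (intro power_mono mult_left_mono) (auto simp: b_def)
      also have "b n * (?r ^ n / fact n) = norm ((deriv ^^ n) f 0 / fact n * of_real ?r ^ n)"
        by (simp add: b_def norm_mult norm_divide norm_power)
      finally show "(b n)\<^sup>2 * (exp (- 4) * exp ?r / real k)\<^sup>2
          \<le> (norm ((deriv ^^ n) f 0 / fact n * of_real ?r ^ n))\<^sup>2"
        by (simp only: power_mult_distrib)
    qed
    ultimately have "(\<Sum>n\<in>?W. (b n)\<^sup>2) * (exp (- 4) * exp ?r / real k)\<^sup>2 \<le> K * (exp ?r)\<^sup>2 / sqrt ?r"
      by (simp only: sum_distrib_right)
    also have "(\<Sum>n\<in>?W. (b n)\<^sup>2) * (exp (- 4) * exp ?r / real k)\<^sup>2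
        = (\<Sum>n\<in>?W. (b n)\<^sup>2) * (exp (- 4))\<^sup>2 * ((exp ?r)\<^sup>2 / (real k)\<^sup>2)"
      by (simp only: power_mult_distrib power_divide times_divide_eq_right mult.assoc)
    also have "K * (exp ?r)\<^sup>2 / sqrt ?r = K * real k * ((exp ?r)\<^sup>2 / (real k)\<^sup>2)"
      using k by (simp add: power2_eq_square)
    finally have "(\<Sum>n\<in>?W. (b n)\<^sup>2) * (exp (- 4))\<^sup>2 \<le> K * real k"
      by (rule mult_right_le_imp_le) (use k in simp)
    then have le: "exp 8 * ((\<Sum>n\<in>?W. (b n)\<^sup>2) * (exp (- 4))\<^sup>2) \<le> exp 8 * (K * real k)"
      by simp
    have "exp 8 * (exp (- 4))\<^sup>2 = (1::real)"
      by (simp add: power2_eq_square flip: exp_add)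
    then have "(\<Sum>n\<in>?W. (b n)\<^sup>2) = exp 8 * (exp (- 4))\<^sup>2 * (\<Sum>n\<in>?W. (b n)\<^sup>2)"
      by (simp only: mult_1)
    also have "\<dots> = exp 8 * ((\<Sum>n\<in>?W. (b n)\<^sup>2) * (exp (- 4))\<^sup>2)"
      by (simp only: mult_ac)
    also note le
    finally show ?thesis by (simp add: K'_def mult_ac)
  qed
  \<comment> \<open>Collects the finitely many windows below the radius from which the growth bound
    holds.\<close>
  define D where "D = (\<Sum>n<k0\<^sup>2. (b n)\<^sup>2)"
  have D: "D \<ge> 0" unfolding D_def by (intro sum_nonneg) auto
  have squares: "(\<Sum>n<k\<^sup>2. (b n)\<^sup>2) \<le> D + K' * real (k\<^sup>2)" for k
  proof (cases "k0 \<le> k")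
    case True
    then show ?thesis
    proof (induction k rule: nat_induct_at_least)
      case base
      then show ?case using K' by (simp add: D_def)
    next
      case (Suc k)
      have "{..<(Suc k)\<^sup>2} = {..<k\<^sup>2} \<union> {k\<^sup>2..<(Suc k)\<^sup>2}"
        by (auto simp: power2_eq_square)
      then have "(\<Sum>n<(Suc k)\<^sup>2. (b n)\<^sup>2) = (\<Sum>n<k\<^sup>2. (b n)\<^sup>2) + (\<Sum>n\<in>{k\<^sup>2..<(Suc k)\<^sup>2}. (b n)\<^sup>2)"
        by (simp add: sum.union_disjoint ivl_disj_int)
      also have "\<dots> \<le> D + K' * real (k\<^sup>2) + K' * real k"
        using Suc block by (intro add_mono) auto
      also have "\<dots> \<le> D + K' * real ((Suc k)\<^sup>2)"
        using K' by (simp add: power2_eq_square algebra_simps)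
      finally show ?case .
    qed
  next
    case False
    then have "(\<Sum>n<k\<^sup>2. (b n)\<^sup>2) \<le> D"
      unfolding D_def by (intro sum_mono2) (auto intro: less_le_trans power_mono)
    then show ?thesis using K' by (simp add: add_increasing2)
  qed
  have "(\<Sum>n<N. b n) \<le> (D + 3 * K' + 1) * (real N + 1)" for N
  proof -
    have "\<exists>k. k\<^sup>2 \<le> N \<and> N < (Suc k)\<^sup>2"
    proof (induction N)
      case (Suc N)
      then obtain k where "k\<^sup>2 \<le> N" "N < (Suc k)\<^sup>2" by blast
      then show ?case
        by (cases "Suc N < (Suc k)\<^sup>2") (auto intro: exI[of _ k] exI[of _ "Suc k"] simp: power2_eq_square)
    qed simp
    then obtain k where k: "k\<^sup>2 \<le> N" "N < (Suc k)\<^sup>2" by blast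
    \<comment> \<open>Rounding \<open>N\<close> up to the next square costs only a constant factor,
      so arbitrary \<open>N\<close> inherit the linear bound.\<close>
    have "(Suc k)\<^sup>2 = k * k + 2 * k + 1" "k \<le> k * k" "k * k \<le> N"
      using k(1) by (simp_all add: power2_eq_square)
    then have "(Suc k)\<^sup>2 \<le> 3 * N + 1" by linarith
    then have Sk: "real ((Suc k)\<^sup>2) \<le> 3 * real N + 1" by linarith
    have "(\<Sum>n<N. b n) \<le> (\<Sum>n<N. 1 + (b n)\<^sup>2)"
    proof (rule sum_mono)
      fix n
      have "0 \<le> (b n - 1)\<^sup>2" by simp
      then have "2 * b n \<le> 1 + (b n)\<^sup>2" by (simp add: power2_diff)
      moreover have "0 \<le> b n" by (simp add: b_def)
      ultimately show "b n \<le> 1 + (b n)\<^sup>2" by linarith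
    qed
    also have "\<dots> = real N + (\<Sum>n<N. (b n)\<^sup>2)" by (simp add: sum.distrib)
    also have "(\<Sum>n<N. (b n)\<^sup>2) \<le> (\<Sum>n<(Suc k)\<^sup>2. (b n)\<^sup>2)"
      using k by (intro sum_mono2) auto
    also have "\<dots> \<le> D + K' * real ((Suc k)\<^sup>2)" by (rule squares)
    also have "\<dots> \<le> D + K' * (3 * real N + 1)"
      using K' Sk by (intro add_left_mono mult_left_mono) auto
    also have "real N + (D + K' * (3 * real N + 1)) \<le> (D + 3 * K' + 1) * (real N + 1)"
      using D K' by (simp add: algebra_simps)
    finally show ?thesis by simp
  qed
  then show ?thesis using that[of "D + 3 * K' + 1"] unfolding b_def by blast
qed

section \<open>Cesaro means of the seminorms along the orbit\<close>

lemma sums_power_over_fact: "(\<lambda>k. x ^ k / fact k) sums exp (x::real)"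
  using exp_converges[of x] by (simp add: divide_inverse mult.commute)

text \<open>The factor \<open>k\<close> cancels in the factorial and shifts the index. In terms of a
  Poisson variable X with mean x: E[X g(X)] = x E[g(X + 1)], from which all moments follow.\<close>

lemma sums_times_power_over_fact:
  fixes x s :: real
  assumes "(\<lambda>k. g (Suc k) * x ^ k / fact k) sums s"
  shows "(\<lambda>k. real k * g k * x ^ k / fact k) sums (x * s)"
proof -
  have "real (Suc k) * g (Suc k) * x ^ Suc k / fact (Suc k) = x * (g (Suc k) * x ^ k / fact k)" for k
    by (simp add: field_simps del: of_nat_Suc)
  then have "(\<lambda>k. real (Suc k) * g (Suc k) * x ^ Suc k / fact (Suc k)) sums (x * s)"
    using sums_mult[OF assms, of x] by (simp only:)
  then show ?thesis
    using sums_Suc_iff[of "\<lambda>k. real k * g k * x ^ k / fact k"] by simp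
qed

lemma sums_linear_power_over_fact:
  fixes x c :: real
  shows "(\<lambda>k. (c + real k) * x ^ k / fact k) sums ((c + x) * exp x)"
proof -
  have "(\<lambda>k. real k * 1 * x ^ k / fact k) sums (x * exp x)"
    by (rule sums_times_power_over_fact) (use sums_power_over_fact in simp)
  from sums_add[OF sums_mult[OF sums_power_over_fact[of x], of c] this]
  show ?thesis by (simp add: algebra_simps add_divide_distrib)
qed

lemma holomorphic_on_funpow_deriv:
  assumes "f holomorphic_on UNIV"
  shows "(deriv ^^ n) f holomorphic_on UNIV"
  by (rule holomorphic_higher_deriv[OF assms open_UNIV])

lemma entire_seminorm_nonneg:
  assumes "f holomorphic_on UNIV"
  shows "0 \<le> entire_seminorm m f"
proof -
  have "continuous_on (cball 0 (real m)) (\<lambda>z. norm (f z))"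
    by (intro continuous_on_norm holomorphic_on_imp_continuous_on holomorphic_on_subset[OF assms]) auto
  then have "bdd_above ((\<lambda>z. norm (f z)) ` cball 0 (real m))"
    by (intro bounded_imp_bdd_above compact_imp_bounded compact_continuous_image compact_cball)
  then have "norm (f 0) \<le> entire_seminorm m f"
    unfolding entire_seminorm_def by (intro cSUP_upper) auto
  then show ?thesis using norm_ge_zero order_trans by blast
qed

lemma entire_seminorm_le:
  assumes "\<And>z. norm z \<le> real m \<Longrightarrow> norm (f z) \<le> C"
  shows "entire_seminorm m f \<le> C"
  unfolding entire_seminorm_def by (rule cSUP_least) (auto intro: assms)

text \<open>The Taylor expansion bounds the seminorm of the n-th derivative by a Poisson-weighted
  sum of the \<open>b (n + k)\<close>. After exchanging the sums, the shift by \<open>k\<close>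
  turns the hypothesis for \<open>N\<close> into that for \<open>N + k\<close>; this is linear in
  \<open>k\<close>, so the first Poisson moment finishes.\<close>

lemma sum_entire_seminorm_le:
  fixes f :: "complex \<Rightarrow> complex"
  assumes f: "f holomorphic_on UNIV"
    and E: "\<And>N. (\<Sum>n<N. norm ((deriv ^^ n) f 0)) \<le> E * (real N + 1)"
  shows "(\<Sum>n<N. entire_seminorm m ((deriv ^^ n) f)) \<le> E * exp m * (real N + (1 + real m))"
proof -
  define b where "b n = norm ((deriv ^^ n) f 0)" for n
  have b0: "b n \<ge> 0" for n by (simp add: b_def)
  have E0: "E \<ge> 0" using E[of 0] by simp
  let ?u = "\<lambda>n k. b (n + k) * real m ^ k / fact k"
  \<comment> \<open>Crude bound of a term by its partial sum; it serves only to make the series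
    summable.\<close>
  have bE: "b n \<le> E * (real n + 2)" for n
  proof -
    have "b n \<le> (\<Sum>i<Suc n. b i)"
      using b0 by (simp add: sum_nonneg)
    also have "\<dots> \<le> E * (real (Suc n) + 1)"
      unfolding b_def by (rule E)
    finally show ?thesis by (simp add: add_ac)
  qed
  have summ: "summable (?u n)" for n
  proof (rule summable_comparison_test')
    show "summable (\<lambda>k. E * ((real n + 2 + real k) * real m ^ k / fact k))"
      by (intro summable_mult sums_summable[OF sums_linear_power_over_fact])
    fix k
    have "b (n + k) * (real m ^ k / fact k) \<le> E * (real (n + k) + 2) * (real m ^ k / fact k)"
      by (intro mult_right_mono bE) auto
    then show "norm (?u n k) \<le> E * ((real n + 2 + real k) * real m ^ k / fact k)"
      using b0[of "n + k"] by (simp add: add_ac mult_ac)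
  qed
  have semi: "entire_seminorm m ((deriv ^^ n) f) \<le> (\<Sum>k. ?u n k)" for n
  proof (rule entire_seminorm_le)
    fix z :: complex assume z: "norm z \<le> real m"
    have "(deriv ^^ n) f holomorphic_on ball 0 (real m + 1)"
      using holomorphic_on_funpow_deriv[OF f] holomorphic_on_subset by blast
    from holomorphic_power_series[OF this, of z]
    have s: "(\<lambda>k. (deriv ^^ k) ((deriv ^^ n) f) 0 / fact k * z ^ k) sums (deriv ^^ n) f z"
      using z by simp
    have eq: "(deriv ^^ k) ((deriv ^^ n) f) = (deriv ^^ (n + k)) f" for k
      by (metis add.commute comp_apply funpow_add)
    have le: "norm ((deriv ^^ k) ((deriv ^^ n) f) 0 / fact k * z ^ k) \<le> ?u n k" for k
    proof -
      have "norm ((deriv ^^ k) ((deriv ^^ n) f) 0 / fact k * z ^ k) = b (n + k) / fact k * norm z ^ k"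
        by (simp add: eq b_def norm_mult norm_divide norm_power)
      also have "\<dots> \<le> b (n + k) / fact k * real m ^ k"
        using z b0 by (intro mult_left_mono power_mono) auto
      finally show ?thesis by simp
    qed
    have "norm (\<Sum>k. (deriv ^^ k) ((deriv ^^ n) f) 0 / fact k * z ^ k) \<le> (\<Sum>k. ?u n k)"
      by (rule norm_suminf_le[OF le summ])
    then show "norm ((deriv ^^ n) f z) \<le> (\<Sum>k. ?u n k)"
      using sums_unique[OF s] by simp
  qed
  have "(\<Sum>n<N. entire_seminorm m ((deriv ^^ n) f)) \<le> (\<Sum>n<N. \<Sum>k. ?u n k)"
    by (intro sum_mono semi)
  also have "\<dots> = (\<Sum>k. \<Sum>n<N. ?u n k)"
    by (rule suminf_sum[symmetric]) (rule summ)
  also have "\<dots> \<le> (\<Sum>k. E * ((real N + 1 + real k) * real m ^ k / fact k))"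
  proof (rule suminf_le)
    fix k
    have "(\<Sum>n<N. b (n + k)) = (\<Sum>n\<in>{k..<N + k}. b n)"
      by (simp add: sum.shift_bounds_nat_ivl[of b 0 k N, simplified] lessThan_atLeast0)
    also have "\<dots> \<le> (\<Sum>n<N + k. b n)"
      using b0 by (intro sum_mono2) auto
    also have "\<dots> \<le> E * (real (N + k) + 1)"
      unfolding b_def by (rule E)
    finally have "(\<Sum>n<N. b (n + k)) * (real m ^ k / fact k) \<le> E * (real (N + k) + 1) * (real m ^ k / fact k)"
      by (intro mult_right_mono) auto
    moreover have "(\<Sum>n<N. ?u n k) = (\<Sum>n<N. b (n + k)) * (real m ^ k / fact k)"
      by (simp add: sum_distrib_right sum_divide_distrib)
    ultimately show "(\<Sum>n<N. ?u n k) \<le> E * ((real N + 1 + real k) * real m ^ k / fact k)"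
      by (simp add: add_ac mult_ac)
  next
    show "summable (\<lambda>k. \<Sum>n<N. ?u n k)"
      by (intro summable_sum summ)
    show "summable (\<lambda>k. E * ((real N + 1 + real k) * real m ^ k / fact k))"
      by (intro summable_mult sums_summable[OF sums_linear_power_over_fact])
  qed
  also have "\<dots> = E * ((real N + 1 + real m) * exp (real m))"
    by (rule sums_unique[symmetric]) (intro sums_mult sums_linear_power_over_fact)
  finally show ?thesis by (simp add: algebra_simps)
qed

text \<open>Markov's inequality: bounded means leave room for the values above a large
  \<open>K\<close> only on a small proportion of the indices.\<close>

lemma not_tendsto_infinity_on_full_upper_density:
  fixes s :: "nat \<Rightarrow> real"
  assumes s0: "\<And>n. 0 \<le> s n" and E: "\<And>N. (\<Sum>n<N. s n) \<le> E * (real N + L)"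
    and B: "upper_density B = 1"
  shows "\<not> filterlim s at_top (inf sequentially (principal B))"
proof
  assume lim: "filterlim s at_top (inf sequentially (principal B))"
  \<comment> \<open>Large values take up at most about a quarter of the indices; another quarter
    absorbs the constants, which leaves upper density at most 1/2. The summand 1 keeps
    \<open>K\<close> positive.\<close>
  define K where "K = 4 * \<bar>E\<bar> + 1"
  have K: "K > 0" by (simp add: K_def)
  have "\<forall>\<^sub>F n in sequentially. n \<in> B \<longrightarrow> K \<le> s n"
    using filterlim_at_top[THEN iffD1, OF lim] by (simp add: eventually_inf_principal)
  then obtain n0 where n0: "\<And>n. n \<ge> n0 \<Longrightarrow> n \<in> B \<Longrightarrow> K \<le> s n"
    unfolding eventually_sequentially by blast
  have card_le: "real (card (B \<inter> {1..N})) \<le> real n0 + (real N + (1 + \<bar>L\<bar>)) / 4" for N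
  proof -
    let ?A = "{n \<in> B. n0 \<le> n \<and> n \<le> N}"
    have "card (B \<inter> {1..N}) \<le> card ({..<n0} \<union> ?A)"
      by (intro card_mono) auto
    also have "\<dots> \<le> n0 + card ?A"
      by (rule card_Un_le[THEN order_trans]) simp
    finally have 1: "real (card (B \<inter> {1..N})) \<le> real n0 + real (card ?A)"
      by linarith
    have "real (card ?A) * K = (\<Sum>n\<in>?A. K)" by simp
    also have "\<dots> \<le> (\<Sum>n\<in>?A. s n)"
      by (intro sum_mono n0) auto
    also have "\<dots> \<le> (\<Sum>n<Suc N. s n)"
      by (intro sum_mono2 s0) auto
    also have "\<dots> \<le> E * (real (Suc N) + L)" by (rule E)
    also have "\<dots> \<le> \<bar>E\<bar> * (real N + (1 + \<bar>L\<bar>))"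
      by (rule order_trans[OF abs_ge_self]) (simp add: abs_mult mult_left_mono)
    also have "\<dots> \<le> K / 4 * (real N + (1 + \<bar>L\<bar>))"
      by (intro mult_right_mono) (auto simp: K_def)
    finally have "K * real (card ?A) \<le> K * ((real N + (1 + \<bar>L\<bar>)) / 4)"
      by (simp add: mult_ac)
    then have "real (card ?A) \<le> (real N + (1 + \<bar>L\<bar>)) / 4"
      using K by simp
    with 1 show ?thesis by linarith
  qed
  obtain N0 :: nat where N0: "4 * (real n0 + (1 + \<bar>L\<bar>) / 4) \<le> real N0"
    using real_arch_simple by blast
  have "\<forall>\<^sub>F n in sequentially. ereal (real (card (B \<inter> {1..n})) / real n) \<le> ereal (1 / 2)"
    using eventually_ge_at_top[of "Suc N0"]
  proof eventually_elim
    case (elim n)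
    then have "real (card (B \<inter> {1..n})) \<le> real n / 2"
      using card_le[of n] N0 by (simp add: add_divide_distrib)
    then show ?case using elim by (simp add: divide_simps)
  qed
  then have "upper_density B \<le> ereal (1 / 2)"
    unfolding upper_density_def by (rule Limsup_bounded)
  with B show False by (simp add: one_ereal_def)
qed

lemma not_distributionally_unbounded:
  fixes f :: "complex \<Rightarrow> complex"
  assumes f: "f holomorphic_on UNIV" and p: "1 \<le> p" and c: "c > 0"
    and M: "\<forall>\<^sub>F r in at_top. M_mean p f r \<le> c * (exp r / r powr real_of_ereal (1 / (2 * min 2 p)))"
  shows "\<not> distributionally_unbounded entire_seminorm deriv f"
proof
  assume "distributionally_unbounded entire_seminorm deriv f"
  then obtain m B where B: "upper_density B = 1"
    "filterlim (\<lambda>n. entire_seminorm m ((deriv ^^ n) f)) at_top (inf sequentially (principal B))"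
    unfolding distributionally_unbounded_def by blast
  obtain E where "\<And>N. (\<Sum>n<N. norm ((deriv ^^ n) f 0)) \<le> E * (real N + 1)"
    using sum_derivs_le[OF f p c M] by blast
  from not_tendsto_infinity_on_full_upper_density
      [OF entire_seminorm_nonneg[OF holomorphic_on_funpow_deriv[OF f]] sum_entire_seminorm_le[OF f this] B(1)]
  show False using B(2) by blast
qed

section \<open>Growth of exponential series\<close>

text \<open>As a function of \<open>r\<close>, the quotient of \<open>r ^ n\<close> by
  \<open>exp r\<close> is largest at \<open>r = n\<close>, where Stirling applies.\<close>

lemma power_over_fact_le_at:
  assumes n: "n \<ge> 1" and r: "r \<ge> 0"
  shows "r ^ n / fact n \<le> exp r / sqrt (real n)"
proof -
  have "(r / real n) ^ n \<le> exp (r / real n - 1) ^ n"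
    using exp_ge_add_one_self[of "r / real n - 1"] r by (intro power_mono) auto
  also have "\<dots> = exp (r - real n)"
    using n by (simp add: right_diff_distrib flip: exp_of_nat_mult)
  finally have "r ^ n \<le> exp (r - real n) * real n ^ n"
    using n by (simp add: power_divide field_simps)
  then have "sqrt (real n) * r ^ n \<le> sqrt (real n) * (exp (r - real n) * real n ^ n)"
    by (intro mult_left_mono) auto
  also have "\<dots> = exp (r - real n) * (sqrt (real n) * real n ^ n)" by simp
  also have "\<dots> \<le> exp (r - real n) * (fact n * exp (real n))"
    using Stirling_lower[OF n] by (intro mult_left_mono) auto
  also have "\<dots> = fact n * exp r"
    by (simp add: exp_diff)
  finally show ?thesis
    using n by (simp add: field_simps)
qed

text \<open>For \<open>n\<close> much smaller than \<open>r\<close> the bound by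
  \<open>sqrt n\<close> is too weak. A bound uniform in \<open>n\<close> is what allows one of the
  two weights in a squared Taylor term to be pulled out of the sum.\<close>

lemma power_over_fact_le:
  fixes r :: real
  assumes r: "r > 0"
  shows "r ^ n / fact n \<le> 2 * exp r / sqrt r"
proof (cases "n = 0")
  case True
  have "sqrt r \<le> 1 + r"
    by (rule real_le_lsqrt) (use r in \<open>auto simp: power2_eq_square algebra_simps\<close>)
  also have "\<dots> \<le> 2 * exp r"
    using exp_ge_add_one_self[of r] r by linarith
  finally show ?thesis using True r by (simp add: field_simps)
next
  case False
  then have n: "n \<ge> 1" by simp
  \<comment> \<open>AM-GM: \<open>2 sqrt (r n) \<le> r + n\<close>; the factor \<open>r\<close> is absorbed by passing from \<open>n\<close> to \<open>n + 1\<close>.\<close>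
  have "0 \<le> (sqrt r - sqrt (real n))\<^sup>2" by simp
  then have "2 * (sqrt r * sqrt (real n)) \<le> r + real n"
    using r by (simp add: power2_diff)
  then have "2 * (sqrt r * sqrt (real n)) * (r ^ n / fact n) \<le> (r + real n) * (r ^ n / fact n)"
    using r by (intro mult_right_mono) auto
  also have "\<dots> = real (Suc n) * (r ^ Suc n / fact (Suc n)) + real n * (r ^ n / fact n)"
    by (simp add: field_simps del: of_nat_Suc)
  also have "\<dots> \<le> real (Suc n) * (exp r / sqrt (real (Suc n))) + real n * (exp r / sqrt (real n))"
    using r n by (intro add_mono mult_left_mono power_over_fact_le_at) auto
  also have "\<dots> = (sqrt (real (Suc n)) + sqrt (real n)) * exp r"
  proof -
    have "x * (exp r / sqrt x) = sqrt x * exp r" if "x \<ge> 0" for x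
    proof -
      have "x * (exp r / sqrt x) = x / sqrt x * exp r" by simp
      then show ?thesis by (simp only: real_div_sqrt[OF that])
    qed
    then show ?thesis by (simp only: distrib_right of_nat_0_le_iff)
  qed
  also have "\<dots> \<le> (4 * sqrt (real n)) * exp r"
  proof (intro mult_right_mono)
    have "sqrt (real (Suc n)) \<le> sqrt (4 * real n)"
      using n by (intro real_sqrt_le_mono) auto
    then show "sqrt (real (Suc n)) + sqrt (real n) \<le> 4 * sqrt (real n)"
      using real_sqrt_ge_zero[of "real n"] by (simp only: real_sqrt_mult real_sqrt_four) linarith
  qed simp
  finally have "2 * sqrt (real n) * (sqrt r * (r ^ n / fact n)) \<le> 2 * sqrt (real n) * (2 * exp r)"
    by (simp add: mult_ac)
  then have "sqrt r * (r ^ n / fact n) \<le> 2 * exp r"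
    using n by (subst (asm) mult_le_cancel_left_pos) auto
  then show ?thesis using r by (simp add: field_simps)
qed

lemma powr_eq_square_times:
  fixes x q :: real
  assumes "x > 0"
  shows "x powr q = x powr (q - 2) * x\<^sup>2"
  using assms by (simp add: powr_diff)

text \<open>For finite \<open>q \<ge> 2\<close>, all but two of the factors in
  \<open>N t powr q\<close> are estimated by the supremum; for \<open>q < 2\<close> the mean square
  alone decides. The exponent 1/(2 max(2, p)) is the outcome of these two cases, with 0 for the
  supremum itself.\<close>

lemma M_mean_le_of_sup_and_square_bounds:
  fixes p :: ereal
  assumes f: "f holomorphic_on UNIV" and p: "1 \<le> p" and r: "r \<ge> 1" and C: "C > 0"
    and sup: "\<And>z. norm z = r \<Longrightarrow> norm (f z) \<le> C * exp r"
    and sq: "integral {0..2 * pi} (\<lambda>t. (norm (f (of_real r * cis t)))\<^sup>2) \<le> 2 * pi * (C\<^sup>2 * (exp r)\<^sup>2 / sqrt r)"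
  shows "M_mean p f r \<le> 2 * C * (exp r / r powr real_of_ereal (1 / (2 * max 2 p)))"
proof (cases p)
  case PInf
  have "M_mean p f r = (SUP z\<in>sphere 0 r. norm (f z))"
    by (simp add: PInf M_mean_def)
  also have "\<dots> \<le> C * exp r"
    using r sup by (intro cSUP_least) auto
  also have "\<dots> \<le> 2 * C * exp r" using C by simp
  finally show ?thesis using r by (simp add: PInf max_def)
next
  case (real q)
  have q: "1 \<le> q" using p real by simp
  define N where "N t = norm (f (of_real r * cis t))" for t
  have N0: "N t \<ge> 0" for t by (simp add: N_def)
  have NC: "N t \<le> C * exp r" for t
    unfolding N_def using r by (intro sup) (simp add: norm_mult)
  have cont: "continuous_on {0..2 * pi} N"
    unfolding N_def by (intro continuous_on_norm continuous_on_circle f)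
  have cq: "continuous_on {0..2 * pi} (\<lambda>t. N t powr q)"
    unfolding N_def using q by (intro continuous_on_norm_powr continuous_on_circle f) auto
  have Iq0: "integral {0..2 * pi} (\<lambda>t. N t powr q) \<ge> 0"
    by (intro integral_nonneg integrable_continuous_real cq) auto
  have sq: "integral {0..2 * pi} (\<lambda>t. (N t)\<^sup>2) \<le> 2 * pi * (C\<^sup>2 * (exp r)\<^sup>2 / sqrt r)"
    using sq by (simp add: N_def)
  have M: "M_mean p f r \<le> D powr (1 / q)"
    if "integral {0..2 * pi} (\<lambda>t. N t powr q) \<le> 2 * pi * D" for D
  proof -
    have "1 / (2 * pi) * integral {0..2 * pi} (\<lambda>t. N t powr q) \<le> D"
      using that by (simp add: field_simps)
    then show ?thesis
      unfolding real M_mean_ereal using Iq0 q by (fold N_def) (intro powr_mono2, auto)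
  qed
  show ?thesis
  proof (cases "2 \<le> q")
    case True
    let ?l = "C * exp r"
    have a: "real_of_ereal (1 / (2 * max 2 p)) = 1 / (2 * q)"
      using True by (simp add: real one_ereal_def max_def)
    have "integral {0..2 * pi} (\<lambda>t. N t powr q) \<le> integral {0..2 * pi} (\<lambda>t. ?l powr (q - 2) * (N t)\<^sup>2)"
    proof (intro integral_le integrable_continuous_real cq continuous_intros cont)
      fix t
      show "N t powr q \<le> ?l powr (q - 2) * (N t)\<^sup>2"
      proof (cases "N t = 0")
        case False
        then have "N t powr q = N t powr (q - 2) * (N t)\<^sup>2"
          using N0[of t] by (intro powr_eq_square_times) auto
        also have "\<dots> \<le> ?l powr (q - 2) * (N t)\<^sup>2"
          using NC N0 True by (intro mult_right_mono powr_mono2) auto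
        finally show ?thesis .
      qed simp
    qed
    also have "\<dots> = ?l powr (q - 2) * integral {0..2 * pi} (\<lambda>t. (N t)\<^sup>2)" by simp
    also have "\<dots> \<le> ?l powr (q - 2) * (2 * pi * (C\<^sup>2 * (exp r)\<^sup>2 / sqrt r))"
      by (intro mult_left_mono sq) auto
    also have "\<dots> = 2 * pi * (?l powr q / sqrt r)"
      using powr_eq_square_times[of ?l q] C by (simp add: power_mult_distrib)
    finally have "M_mean p f r \<le> (?l powr q / sqrt r) powr (1 / q)"
      by (rule M)
    also have "\<dots> = C * (exp r / r powr (1 / (2 * q)))"
      using C q r by (simp add: powr_divide powr_powr flip: powr_half_sqrt)
    also have "\<dots> \<le> 2 * C * (exp r / r powr (1 / (2 * q)))"
      using C r by (intro mult_right_mono) auto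
    finally show ?thesis by (simp only: a)
  next
    case False
    \<comment> \<open>The root mean square; splitting at this height makes both summands equal after
      integration.\<close>
    let ?l = "C * (exp r / r powr (1 / 4))"
    have l: "?l > 0" using C r by simp
    have a: "real_of_ereal (1 / (2 * max 2 p)) = 1 / 4"
      using False by (simp add: real one_ereal_def max_def)
    have "(r powr (1 / 4))\<^sup>2 = sqrt r"
      using r by (simp add: powr_half_sqrt power2_eq_square flip: powr_add)
    then have l2: "?l\<^sup>2 = C\<^sup>2 * (exp r)\<^sup>2 / sqrt r"
      by (simp add: power_mult_distrib power_divide)
    have "integral {0..2 * pi} (\<lambda>t. N t powr q)
        \<le> integral {0..2 * pi} (\<lambda>t. ?l powr q + ?l powr (q - 2) * (N t)\<^sup>2)"
    proof (intro integral_le integrable_continuous_real cq continuous_intros cont)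
      fix t
      show "N t powr q \<le> ?l powr q + ?l powr (q - 2) * (N t)\<^sup>2"
        using powr_le_split[OF N0 l, of q 2 t] q False N0[of t] by simp
    qed
    also have "\<dots> = 2 * pi * ?l powr q + ?l powr (q - 2) * integral {0..2 * pi} (\<lambda>t. (N t)\<^sup>2)"
      by (subst Henstock_Kurzweil_Integration.integral_add)
         (auto intro!: integrable_continuous_real continuous_intros cont)
    also have "\<dots> \<le> 2 * pi * ?l powr q + ?l powr (q - 2) * (2 * pi * ?l\<^sup>2)"
      unfolding l2 by (intro add_left_mono mult_left_mono sq) auto
    also have "\<dots> = 2 * pi * (2 * ?l powr q)"
      using powr_eq_square_times[OF l, of q] by simp
    finally have "M_mean p f r \<le> (2 * ?l powr q) powr (1 / q)"
      by (rule M)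
    also have "\<dots> = 2 powr (1 / q) * ?l"
      using l q C r by (simp add: powr_mult powr_powr abs_mult)
    \<comment> \<open>\<open>1 / q \<le> 1\<close>; this is the origin of the factor 2 in the
      conclusion.\<close>
    also have "\<dots> \<le> 2 powr 1 * ?l"
      using l q by (intro mult_right_mono powr_mono) auto
    finally show ?thesis unfolding a by (simp add: mult_ac)
  qed
qed (use p in auto)

section \<open>Upper density one; series with coefficients \<open>c n / fact n\<close>\<close>

lemma upper_density_eq_1I:
  assumes "\<And>e n0. e > 0 \<Longrightarrow> \<exists>n\<ge>n0. n \<ge> 1 \<and> (1 - e) * real n \<le> real (card (A \<inter> {1..n}))"
  shows "upper_density A = 1"
proof (rule antisym)
  have "real (card (A \<inter> {1..n})) / real n \<le> 1" for n
  proof -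
    have "card (A \<inter> {1..n}) \<le> card {1..n}" by (intro card_mono) auto
    then show ?thesis by (cases "n = 0") auto
  qed
  then show "upper_density A \<le> 1"
    unfolding upper_density_def by (intro Limsup_bounded) (auto simp: one_ereal_def)
  show "1 \<le> upper_density A"
  proof (rule ccontr)
    assume "\<not> 1 \<le> upper_density A"
    then obtain c where c: "upper_density A < ereal c" "ereal c < 1"
      using ereal_dense2[of "upper_density A" 1] by (auto simp: not_le)
    then have "\<forall>\<^sub>F n in sequentially. ereal (real (card (A \<inter> {1..n})) / real n) < ereal c"
      using Limsup_le_iff[of sequentially "\<lambda>n. ereal (real (card (A \<inter> {1..n})) / real n)" "upper_density A"]
      unfolding upper_density_def by blast
    then obtain n0 where n0: "\<And>n. n \<ge> n0 \<Longrightarrow> real (card (A \<inter> {1..n})) / real n < c"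
      unfolding eventually_sequentially by auto
    have "c < 1" using c(2) by (simp add: one_ereal_def)
    then obtain n where "n \<ge> n0" "n \<ge> 1" "c * real n \<le> real (card (A \<inter> {1..n}))"
      using assms[of "1 - c" n0] by auto
    with n0[of n] show False by (simp add: divide_less_eq)
  qed
qed

lemma has_field_derivative_exp_series:
  fixes c :: "nat \<Rightarrow> complex"
  assumes "\<And>z. summable (\<lambda>n. c n / fact n * z ^ n)"
  shows "((\<lambda>z. \<Sum>n. c n / fact n * z ^ n) has_field_derivative (\<Sum>n. c (Suc n) / fact n * z ^ n)) (at z)"
proof -
  have "diffs (\<lambda>n. c n / fact n) = (\<lambda>n. c (Suc n) / fact n)"
    by (simp add: diffs_def fun_eq_iff field_simps del: of_nat_Suc)
  then show ?thesis
    using termdiffs_strong_converges_everywhere[OF assms, of z] by simp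
qed

lemma summable_exp_series_Suc:
  fixes c :: "nat \<Rightarrow> complex"
  assumes "\<And>z. summable (\<lambda>n. c n / fact n * z ^ n)"
  shows "summable (\<lambda>n. c (Suc n) / fact n * z ^ n)"
proof -
  have "diffs (\<lambda>n. c n / fact n) = (\<lambda>n. c (Suc n) / fact n)"
    by (simp add: diffs_def fun_eq_iff field_simps del: of_nat_Suc)
  then show ?thesis
    using termdiff_converges_all[OF assms, of z] by simp
qed

text \<open>With the normalization by factorials, differentiation is the backward shift of the
  coefficients, so that an orbit of \<open>deriv\<close> is read off from the tails of
  \<open>c\<close>.\<close>

lemma funpow_deriv_exp_series:
  fixes c :: "nat \<Rightarrow> complex"
  assumes "\<And>z. summable (\<lambda>n. c n / fact n * z ^ n)"
  shows "(deriv ^^ m) (\<lambda>z. \<Sum>n. c n / fact n * z ^ n) = (\<lambda>z. \<Sum>n. c (m + n) / fact n * z ^ n)"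
proof -
  have s: "summable (\<lambda>n. c (m + n) / fact n * z ^ n)" for m z
  proof (induction m arbitrary: z)
    case (Suc m)
    from summable_exp_series_Suc[of "\<lambda>n. c (m + n)", OF Suc.IH] show ?case by simp
  qed (use assms in simp)
  show ?thesis
  proof (induction m)
    case (Suc m)
    have "(deriv ^^ Suc m) (\<lambda>z. \<Sum>n. c n / fact n * z ^ n) = deriv (\<lambda>z. \<Sum>n. c (m + n) / fact n * z ^ n)"
      by (simp only: funpow.simps o_apply Suc.IH)
    also have "\<dots> = (\<lambda>z. \<Sum>n. c (m + Suc n) / fact n * z ^ n)"
      by (intro ext DERIV_imp_deriv has_field_derivative_exp_series[of "\<lambda>n. c (m + n)"] s)
    finally show ?case by simp
  qed simp
qed

lemma holomorphic_exp_series: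
  fixes c :: "nat \<Rightarrow> complex"
  assumes "\<And>z. summable (\<lambda>n. c n / fact n * z ^ n)"
  shows "(\<lambda>z. \<Sum>n. c n / fact n * z ^ n) holomorphic_on UNIV"
  unfolding holomorphic_on_open[OF open_UNIV]
  using has_field_derivative_exp_series[OF assms] by blast

text \<open>Parseval for the partial sums, which are dominated on the circle by the sum of the
  absolute values.\<close>

lemma integral_norm_square_power_series_le:
  fixes a :: "nat \<Rightarrow> complex"
  assumes s: "summable (\<lambda>n. norm (a n) * r ^ n)" and r: "r \<ge> 0"
    and C: "\<And>M. (\<Sum>n<M. (norm (a n) * r ^ n)\<^sup>2) \<le> C"
  shows "integral {0..2 * pi} (\<lambda>t. (norm (\<Sum>n. a n * (of_real r * cis t) ^ n))\<^sup>2) \<le> 2 * pi * C"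
proof -
  define S where "S M t = (\<Sum>n<M. a n * (of_real r * cis t) ^ n)" for M t
  define B where "B = (\<Sum>n. norm (a n) * r ^ n)"
  have nt: "norm (a n * (of_real r * cis t) ^ n) = norm (a n) * r ^ n" for n t
    using r by (simp add: norm_mult norm_power)
  have S_eq: "S M t = (\<Sum>n<M. (a n * of_real r ^ n) * cis (real n * t))" for M t
    by (simp add: S_def power_mult_distrib Complex.DeMoivre mult_ac)
  have int: "((\<lambda>t. (norm (S M t))\<^sup>2) has_integral 2 * pi * (\<Sum>n<M. (norm (a n) * r ^ n)\<^sup>2)) {0..2 * pi}" for M
    using has_integral_norm_trig_poly[of "{..<M}" "\<lambda>n. a n * of_real r ^ n"] r
    unfolding S_eq by (simp add: norm_mult norm_power)
  have "(\<lambda>M. integral {0..2 * pi} (\<lambda>t. (norm (S M t))\<^sup>2))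
     \<longlonglongrightarrow> integral {0..2 * pi} (\<lambda>t. (norm (\<Sum>n. a n * (of_real r * cis t) ^ n))\<^sup>2)"
  proof (rule dominated_convergence(2))
    show "(\<lambda>t. (norm (S M t))\<^sup>2) integrable_on {0..2 * pi}" for M
      using int by blast
    show "(\<lambda>t. B\<^sup>2) integrable_on {0..2 * pi}"
      by (intro integrable_continuous_real continuous_intros)
    show "norm ((norm (S M t))\<^sup>2) \<le> B\<^sup>2" for M t
    proof -
      have "norm (S M t) \<le> (\<Sum>n<M. norm (a n) * r ^ n)"
        unfolding S_def by (rule order_trans[OF norm_sum]) (simp only: nt order_refl)
      also have "\<dots> \<le> B"
        unfolding B_def using r by (intro sum_le_suminf s) auto
      finally have "(norm (S M t))\<^sup>2 \<le> B\<^sup>2"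
        by (rule power_mono) simp
      then show ?thesis by simp
    qed
    show "(\<lambda>M. (norm (S M t))\<^sup>2) \<longlonglongrightarrow> (norm (\<Sum>n. a n * (of_real r * cis t) ^ n))\<^sup>2" for t
    proof -
      have "summable (\<lambda>n. a n * (of_real r * cis t) ^ n)"
        by (rule summable_norm_cancel) (simp only: nt s)
      then have "(\<lambda>M. S M t) \<longlonglongrightarrow> (\<Sum>n. a n * (of_real r * cis t) ^ n)"
        unfolding S_def by (rule summable_LIMSEQ)
      then show ?thesis by (intro tendsto_intros)
    qed
  qed
  moreover have "integral {0..2 * pi} (\<lambda>t. (norm (S M t))\<^sup>2) \<le> 2 * pi * C" for M
    using integral_unique[OF int] C by simp
  ultimately show ?thesis
    by (intro LIMSEQ_le_const2) auto
qed

section \<open>An irregular function with blockwise constant derivatives at 0\<close>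

text \<open>The factor 2 makes block ends at least double, which controls growth; the unbounded
  factor \<open>k + 2\<close> makes earlier blocks negligible in density. There is no upper bound,
  so \<open>N\<close> can later adapt to a given growth function.\<close>

locale block_sequence =
  fixes N :: "nat \<Rightarrow> nat"
  assumes N_0: "1 \<le> N 0"
    and N_Suc: "2 * (k + 2) * N k \<le> N (Suc k)"
begin

text \<open>The number of the block containing \<open>x\<close>, with 0 for everything below
  \<open>N 0\<close>. The argument is real because radii are compared with indices.\<close>

definition level :: "real \<Rightarrow> nat" where
  "level x = (LEAST j. x < real (N j))"

definition b :: "nat \<Rightarrow> real" where
  "b n = (if even (level (real n)) then 0 else real (level (real n)))"

definition f :: "complex \<Rightarrow> complex" where
  "f z = (\<Sum>n. of_real (b n) / fact n * z ^ n)"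

lemma N_double: "2 * N k \<le> N (Suc k)"
proof -
  have "2 * N k \<le> 2 * (k + 2) * N k" by simp
  then show ?thesis using N_Suc order_trans by blast
qed

lemma N_gt: "k < N k"
proof (induction k)
  case (Suc k)
  then show ?case using N_double[of k] by linarith
qed (use N_0 in simp)

lemma N_mono: "i \<le> j \<Longrightarrow> N i \<le> N j"
  by (rule lift_Suc_mono_le[of N]) (use N_double in \<open>auto intro: order_trans[OF _ N_double]\<close>)

lemma N_power: "2 ^ i * N j \<le> N (j + i)"
proof (induction i)
  case (Suc i)
  then show ?case using N_double[of "j + i"] by simp
qed simp

lemma less_N_level: "x < real (N (level x))"
proof -
  obtain j :: nat where "x \<le> real j" using real_arch_simple by blast
  also have "real j < real (N j)" using N_gt by simp
  finally show ?thesis unfolding level_def by (rule LeastI)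
qed

lemma N_le_of_less_level: "j < level x \<Longrightarrow> real (N j) \<le> x"
  unfolding level_def using not_less_Least by fastforce

lemma level_le: "x < real (N j) \<Longrightarrow> level x \<le> j"
  unfolding level_def by (rule Least_le)

lemma level_eqI:
  assumes "real (N i) \<le> x" "x < real (N (Suc i))"
  shows "level x = Suc i"
proof (rule antisym)
  show "level x \<le> Suc i" by (rule level_le) fact
  show "Suc i \<le> level x"
  proof (rule ccontr)
    assume "\<not> Suc i \<le> level x"
    then have "N (level x) \<le> N i" by (intro N_mono) simp
    then show False using less_N_level[of x] assms(1) by linarith
  qed
qed

lemma level_of_nat_le: "level (real n) \<le> n"
  using N_gt by (intro level_le) simp

text \<open>If \<open>n\<close> lies \<open>i + 1\<close> blocks beyond \<open>r\<close>, doubling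
  gives \<open>n \<ge> 2 ^ i * r\<close>, and \<open>i + 1 \<le> 2 ^ i\<close>. The majorant is
  linear in \<open>n\<close>, and \<open>n / r\<close> has mean 1 under the Poisson weights at
  \<open>r\<close>.\<close>

lemma level_growth:
  assumes r: "r > 0"
  shows "real (level (real n)) \<le> real (level r) + real n / r"
proof (cases "level (real n) \<le> level r")
  case True
  then show ?thesis using r by (simp add: add_increasing2)
next
  case False
  define i where "i = level (real n) - Suc (level r)"
  have i: "level (real n) = Suc (level r + i)" using False by (simp add: i_def)
  have "real (level (real n)) = real (level r) + real (Suc i)" by (simp add: i)
  also have "Suc i \<le> 2 ^ i" using less_exp[of i] by (simp only: Suc_le_eq)
  then have "real (Suc i) \<le> 2 ^ i" by (metis of_nat_le_iff of_nat_numeral of_nat_power)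
  also have "2 ^ i \<le> real n / r"
  proof -
    have "2 ^ i * r \<le> 2 ^ i * real (N (level r))"
      using less_N_level[of r] by (intro mult_left_mono) auto
    also have "\<dots> \<le> real (N (level r + i))"
      using N_power[of i "level r"] by (metis of_nat_le_iff of_nat_mult of_nat_numeral of_nat_power)
    also have "\<dots> \<le> real n"
      by (rule N_le_of_less_level) (simp add: i)
    finally show ?thesis using r by (simp add: le_divide_eq)
  qed
  finally show ?thesis by simp
qed

lemma level_at_top: "filterlim (\<lambda>n. real (level (real n))) at_top sequentially"
  unfolding filterlim_at_top
proof
  fix Z :: real
  obtain j :: nat where j: "Z \<le> real j" using real_arch_simple by blast
  show "\<forall>\<^sub>F n in sequentially. Z \<le> real (level (real n))"
    using eventually_ge_at_top[of "N j"]
  proof eventually_elim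
    case (elim n)
    have "j \<le> level (real n)"
    proof (rule ccontr)
      assume "\<not> j \<le> level (real n)"
      then have "N (level (real n)) \<le> N j" by (intro N_mono) simp
      then show False using less_N_level[of "real n"] elim by linarith
    qed
    then show ?case using j by linarith
  qed
qed

lemma b_nonneg: "0 \<le> b n"
  by (simp add: b_def)

lemma b_le_level: "b n \<le> real (level (real n))"
  by (simp add: b_def)

lemma b_le: "b n \<le> real n"
  using b_le_level[of n] level_of_nat_le[of n] by linarith

lemma summable_b:
  assumes "r \<ge> 0"
  shows "summable (\<lambda>n. b n / fact n * r ^ n)"
proof (rule summable_comparison_test')
  show "summable (\<lambda>n. (0 + real n) * r ^ n / fact n)"
    by (rule sums_summable[OF sums_linear_power_over_fact])
  fix n
  have "b n / fact n * r ^ n \<le> real n / fact n * r ^ n"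
    using assms by (intro mult_right_mono divide_right_mono b_le) auto
  then show "norm (b n / fact n * r ^ n) \<le> (0 + real n) * r ^ n / fact n"
    using assms b_nonneg[of n] by simp
qed

lemma suminf_b_le:
  assumes r: "r > 0"
  shows "(\<Sum>n. b n / fact n * r ^ n) \<le> (real (level r) + 1) * exp r"
proof -
  \<comment> \<open>The majorant from \<open>level_growth\<close>, multiplied and divided by
    \<open>r\<close> to fit the first-moment formula.\<close>
  have s: "(\<lambda>n. (r * real (level r) + real n) * r ^ n / fact n / r) sums ((r * real (level r) + r) * exp r / r)"
    by (intro sums_divide sums_linear_power_over_fact)
  have "(\<Sum>n. b n / fact n * r ^ n) \<le> (\<Sum>n. (r * real (level r) + real n) * r ^ n / fact n / r)"
  proof (rule suminf_le[OF _ summable_b sums_summable[OF s]])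
    fix n
    have "b n * (r ^ n / fact n) \<le> (real (level r) + real n / r) * (r ^ n / fact n)"
      using r by (intro mult_right_mono order_trans[OF b_le_level level_growth]) auto
    also have "\<dots> = (r * real (level r) + real n) * r ^ n / fact n / r"
      using r by (simp add: field_simps)
    finally show "b n / fact n * r ^ n \<le> (r * real (level r) + real n) * r ^ n / fact n / r"
      by simp
  qed (use r in simp)
  also have "\<dots> = (real (level r) + 1) * exp r"
    using r by (subst sums_unique[OF s, symmetric]) (simp add: field_simps)
  finally show ?thesis .
qed

text \<open>One of the two weights in each square is replaced by its uniform bound, which yields the
  factor \<open>1 / sqrt r\<close>; the other one leaves a second Poisson moment of the majorant
  from \<open>level_growth\<close>.\<close>

lemma sum_b_square_le:
  assumes r: "r \<ge> 1"
  shows "(\<Sum>n<M. (b n / fact n * r ^ n)\<^sup>2) \<le> (3 * (real (level r) + 1))\<^sup>2 * (exp r)\<^sup>2 / sqrt r"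
proof -
  let ?L = "real (level r)"
  have r0: "r > 0" using r by simp
  have "(\<lambda>n. real n * real n * r ^ n / fact n) sums (r * ((1 + r) * exp r))"
    using sums_linear_power_over_fact[of 1 r] by (intro sums_times_power_over_fact) simp
  from sums_add[OF sums_mult[OF sums_power_over_fact[of r], of "2 * ?L\<^sup>2"] sums_mult[OF this, of "2 / r\<^sup>2"]]
  have s: "(\<lambda>n. (2 * ?L\<^sup>2 + 2 * (real n / r)\<^sup>2) * (r ^ n / fact n)) sums
      (2 * ?L\<^sup>2 * exp r + 2 / r\<^sup>2 * (r * ((1 + r) * exp r)))"
    by (simp add: power2_eq_square algebra_simps)
  have term_le: "(b n / fact n * r ^ n)\<^sup>2 \<le> 2 * exp r / sqrt r * ((2 * ?L\<^sup>2 + 2 * (real n / r)\<^sup>2) * (r ^ n / fact n))" for n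
  proof -
    have "(b n)\<^sup>2 \<le> (?L + real n / r)\<^sup>2"
      using r0 by (intro power_mono order_trans[OF b_le_level level_growth] b_nonneg) auto
    also have "\<dots> \<le> 2 * ?L\<^sup>2 + 2 * (real n / r)\<^sup>2"
      using zero_le_power2[of "?L - real n / r"] by (simp add: power2_sum power2_diff)
    finally have "(r ^ n / fact n) * ((b n)\<^sup>2 * (r ^ n / fact n))
        \<le> 2 * exp r / sqrt r * ((2 * ?L\<^sup>2 + 2 * (real n / r)\<^sup>2) * (r ^ n / fact n))"
      using r0 by (intro mult_mono power_over_fact_le mult_right_mono) auto
    then show ?thesis by (simp add: power2_eq_square mult_ac)
  qed
  have "(\<Sum>n<M. (b n / fact n * r ^ n)\<^sup>2)
      \<le> (\<Sum>n<M. 2 * exp r / sqrt r * ((2 * ?L\<^sup>2 + 2 * (real n / r)\<^sup>2) * (r ^ n / fact n)))"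
    by (intro sum_mono term_le)
  also have "\<dots> \<le> 2 * exp r / sqrt r * (2 * ?L\<^sup>2 * exp r + 2 / r\<^sup>2 * (r * ((1 + r) * exp r)))"
    unfolding sum_distrib_left[symmetric] sums_unique[OF s]
    using r0 by (intro mult_left_mono sum_le_suminf sums_summable[OF s]) auto
  also have "\<dots> \<le> 2 * exp r / sqrt r * (2 * ?L\<^sup>2 * exp r + 4 * exp r)"
  proof (intro mult_left_mono add_left_mono)
    have "2 / r\<^sup>2 * (r * (1 + r)) \<le> 4"
      using r by (simp add: power2_eq_square field_simps)
    then have "2 / r\<^sup>2 * (r * (1 + r)) * exp r \<le> 4 * exp r"
      by (intro mult_right_mono) auto
    then show "2 / r\<^sup>2 * (r * ((1 + r) * exp r)) \<le> 4 * exp r"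
      by (simp add: mult_ac)
  qed (use r0 in auto)
  also have "\<dots> = (4 * ?L\<^sup>2 + 8) * (exp r)\<^sup>2 / sqrt r"
    by (simp add: power2_eq_square algebra_simps add_divide_distrib)
  \<comment> \<open>A perfect square is wanted because the constant enters the later estimate as
    \<open>C\<^sup>2\<close>.\<close>
  also have "\<dots> \<le> (3 * (?L + 1))\<^sup>2 * (exp r)\<^sup>2 / sqrt r"
  proof (intro divide_right_mono mult_right_mono)
    have "0 \<le> ?L * ?L" by simp
    then show "4 * ?L\<^sup>2 + 8 \<le> (3 * (?L + 1))\<^sup>2"
      by (simp add: power2_eq_square algebra_simps)
  qed (use r0 in auto)
  finally show ?thesis .
qed

lemma norm_b_term: "norm (complex_of_real (b n) / fact n * z ^ n) = b n / fact n * norm z ^ n"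
  using b_nonneg[of n] by (simp add: norm_mult norm_divide norm_power)

lemma summable_f: "summable (\<lambda>n. complex_of_real (b n) / fact n * z ^ n)"
  by (rule summable_norm_cancel) (simp only: norm_b_term summable_b norm_ge_zero)

lemma holomorphic_f: "f holomorphic_on UNIV"
  unfolding f_def[abs_def] by (rule holomorphic_exp_series[OF summable_f])

lemma funpow_deriv_f: "(deriv ^^ m) f z = (\<Sum>n. of_real (b (m + n)) / fact n * z ^ n)"
  unfolding f_def[abs_def] by (simp only: funpow_deriv_exp_series[OF summable_f])

lemma norm_f_le:
  assumes "norm z = r" "r > 0"
  shows "norm (f z) \<le> (real (level r) + 1) * exp r"
proof -
  have "norm (f z) \<le> (\<Sum>n. b n / fact n * r ^ n)"
    unfolding f_def using assms(2)
    by (intro norm_suminf_le summable_b) (auto simp only: norm_b_term assms(1) order_refl less_imp_le)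
  also have "\<dots> \<le> (real (level r) + 1) * exp r"
    by (rule suminf_b_le) fact
  finally show ?thesis .
qed

lemma M_mean_f_le:
  fixes p :: ereal
  assumes p: "1 \<le> p" and r: "r \<ge> 1"
  shows "M_mean p f r \<le> 6 * (real (level r) + 1) * (exp r / r powr real_of_ereal (1 / (2 * max 2 p)))"
proof -
  let ?C = "3 * (real (level r) + 1)"
  have r0: "r > 0" using r by simp
  have "M_mean p f r \<le> 2 * ?C * (exp r / r powr real_of_ereal (1 / (2 * max 2 p)))"
  proof (rule M_mean_le_of_sup_and_square_bounds[OF holomorphic_f p r])
    fix z :: complex assume "norm z = r"
    then have "norm (f z) \<le> (real (level r) + 1) * exp r"
      using r0 by (rule norm_f_le)
    also have "\<dots> \<le> ?C * exp r"
      by (intro mult_right_mono) auto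
    finally show "norm (f z) \<le> ?C * exp r" .
  next
    have nb: "norm (complex_of_real (b n) / fact n) = b n / fact n" for n
      using norm_b_term[of n 1] by simp
    show "integral {0..2 * pi} (\<lambda>t. (norm (f (of_real r * cis t)))\<^sup>2) \<le> 2 * pi * (?C\<^sup>2 * (exp r)\<^sup>2 / sqrt r)"
      unfolding f_def using r0 r
      by (intro integral_norm_square_power_series_le)
         (auto simp only: nb intro!: summable_b sum_b_square_le)
  qed simp
  then show ?thesis by simp
qed

text \<open>First halves of the blocks selected by \<open>P\<close>: from such an \<open>n\<close>,
  the indices up to \<open>2 * n - 1\<close> stay in the block. Even and odd blocks share one
  density computation.\<close>

definition half_blocks :: "(nat \<Rightarrow> bool) \<Rightarrow> nat set" where
  "half_blocks P = {n. P (level (real n)) \<and> 2 * n \<le> N (level (real n))}"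

text \<open>Counted up to the middle \<open>M\<close> of block \<open>Suc j\<close>, the set misses
  at most the indices below \<open>N j\<close>, a proportion of at most
  \<open>1 / (j + 2)\<close>.\<close>

lemma upper_density_half_blocks:
  assumes P: "\<And>i. \<exists>j\<ge>i. P (Suc j)"
  shows "upper_density (half_blocks P) = 1"
proof (rule upper_density_eq_1I)
  fix e :: real and n0 :: nat
  assume e: "e > 0"
  obtain i0 :: nat where i0: "1 / e \<le> real i0" using real_arch_simple by blast
  obtain j where j: "j \<ge> max n0 i0" "P (Suc j)" using P by blast
  define M where "M = N (Suc j) div 2"
  have "(j + 2) * N j * 2 \<le> N (Suc j)" using N_Suc[of j] by (simp add: mult_ac)
  then have M: "(j + 2) * N j \<le> M"
    unfolding M_def by (metis div_le_mono nonzero_mult_div_cancel_right zero_neq_numeral)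
  have M_gt: "2 * M \<le> N (Suc j)" "M < N (Suc j)"
    using N_gt[of "Suc j"] by (auto simp: M_def)
  have sub: "{N j..M} \<subseteq> half_blocks P \<inter> {1..M}"
  proof
    fix n assume n: "n \<in> {N j..M}"
    have "level (real n) = Suc j"
      using n M_gt by (intro level_eqI) auto
    moreover have "1 \<le> n" using n N_gt[of j] by auto
    ultimately show "n \<in> half_blocks P \<inter> {1..M}"
      using n M_gt j by (simp add: half_blocks_def)
  qed
  have "j + 2 \<le> (j + 2) * N j" using N_gt[of j] by simp
  then have jM: "j + 2 \<le> M" using M by linarith
  have "real (N j) \<le> e * real M"
  proof -
    have "1 \<le> e * real i0" using i0 e by (simp add: field_simps)
    also have "\<dots> \<le> e * real (j + 2)" using j e by (intro mult_left_mono) auto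
    finally have "1 * real (N j) \<le> e * real (j + 2) * real (N j)"
      by (intro mult_right_mono) auto
    also have "\<dots> = e * real ((j + 2) * N j)" by (simp only: of_nat_mult mult.assoc)
    also have "\<dots> \<le> e * real M"
      using M e by (intro mult_left_mono) (auto simp only: of_nat_le_iff less_imp_le)
    finally show ?thesis by simp
  qed
  then have "(1 - e) * real M \<le> real M - real (N j)" by (simp add: algebra_simps)
  also have "\<dots> \<le> real (card {N j..M})" by simp
  also have "\<dots> \<le> real (card (half_blocks P \<inter> {1..M}))"
    using card_mono[OF _ sub] by simp
  finally show "\<exists>n\<ge>n0. n \<ge> 1 \<and> (1 - e) * real n \<le> real (card (half_blocks P \<inter> {1..n}))"
    using jM j by (intro exI[of _ M]) auto
qed

lemma b_eq_0_after_half_block: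
  assumes n: "n \<in> half_blocks even" and k: "k < n"
  shows "b (n + k) = 0"
proof -
  have ev: "even (level (real n))" and le: "2 * n \<le> N (level (real n))"
    using n by (auto simp: half_blocks_def)
  show ?thesis
  proof (cases "level (real n)")
    \<comment> \<open>The initial block has no preceding end point, so \<open>level_eqI\<close> does
      not apply to it.\<close>
    case 0
    then have "level (real (n + k)) \<le> 0"
      using le k by (intro level_le) simp
    then show ?thesis by (simp add: b_def)
  next
    case (Suc i)
    have "real (N i) \<le> real n" by (rule N_le_of_less_level) (simp add: Suc)
    then have "level (real (n + k)) = Suc i"
      using le k Suc by (intro level_eqI) auto
    then show ?thesis using ev Suc by (simp add: b_def)
  qed
qed

text \<open>For \<open>n\<close> in the first half of an even block, the n-th derivative has
  vanishing Taylor coefficients of order below \<open>n\<close>, so its seminorm is at most a tail,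
  starting at \<open>n\<close>, of a fixed convergent series.\<close>

lemma near_zero: "distributionally_near_zero entire_seminorm deriv f"
proof -
  have "((\<lambda>n. entire_seminorm m ((deriv ^^ n) f)) \<longlongrightarrow> 0) (inf sequentially (principal (half_blocks even)))" for m
  proof -
    \<comment> \<open>For \<open>k \<ge> n\<close> one has
      \<open>b (n + k) \<le> n + k \<le> 2 * k\<close>, which is free of \<open>n\<close>.\<close>
    define c where "c k = 2 * ((0 + real k) * real m ^ k / fact k)" for k
    have c: "summable c"
      unfolding c_def by (intro summable_mult sums_summable[OF sums_linear_power_over_fact])
    have c0: "c k \<ge> 0" for k by (simp add: c_def)
    have le: "entire_seminorm m ((deriv ^^ n) f) \<le> suminf c - sum c {..<n}" if n: "n \<in> half_blocks even" for n
    proof (rule entire_seminorm_le)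
      fix z :: complex assume z: "norm z \<le> real m"
      let ?d = "\<lambda>k. if k < n then 0 else c k"
      have "?d sums (suminf c - sum c {..<n})"
      proof -
        have "(\<lambda>k. if k \<in> {..<n} then c k else 0) sums sum c {..<n}"
          by (rule sums_If_finite_set) simp
        from sums_diff[OF summable_sums[OF c] this] show ?thesis
          by (rule sums_cong[THEN iffD1, rotated]) auto
      qed
      then have d: "summable ?d" "suminf ?d = suminf c - sum c {..<n}"
        by (auto simp: sums_iff)
      have "norm (\<Sum>k. complex_of_real (b (n + k)) / fact k * z ^ k) \<le> suminf ?d"
      proof (rule norm_suminf_le[OF _ d(1)])
        fix k
        show "norm (complex_of_real (b (n + k)) / fact k * z ^ k) \<le> ?d k"
        proof (cases "k < n")
          case True
          then show ?thesis using b_eq_0_after_half_block[OF n] by simp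
        next
          case False
          have "norm (complex_of_real (b (n + k)) / fact k * z ^ k) = b (n + k) / fact k * norm z ^ k"
            using b_nonneg[of "n + k"] by (simp add: norm_mult norm_divide norm_power)
          also have "\<dots> \<le> (2 * real k) / fact k * real m ^ k"
            using False z b_le[of "n + k"] by (intro mult_mono divide_right_mono power_mono) auto
          finally show ?thesis using False by (simp add: c_def)
        qed
      qed
      then show "norm ((deriv ^^ n) f z) \<le> suminf c - sum c {..<n}"
        by (simp only: funpow_deriv_f d(2))
    qed
    have "(\<lambda>n. suminf c - sum c {..<n}) \<longlonglongrightarrow> suminf c - suminf c"
      by (intro tendsto_intros summable_LIMSEQ c)
    then have lim: "((\<lambda>n. suminf c - sum c {..<n}) \<longlongrightarrow> 0) (inf sequentially (principal (half_blocks even)))"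
      by (intro tendsto_mono[OF inf_le1]) simp
    show ?thesis
    proof (rule tendsto_sandwich[OF _ _ tendsto_const lim])
      show "\<forall>\<^sub>F n in inf sequentially (principal (half_blocks even)). 0 \<le> entire_seminorm m ((deriv ^^ n) f)"
        by (intro always_eventually allI entire_seminorm_nonneg holomorphic_on_funpow_deriv holomorphic_f)
      show "\<forall>\<^sub>F n in inf sequentially (principal (half_blocks even)).
          entire_seminorm m ((deriv ^^ n) f) \<le> suminf c - sum c {..<n}"
        unfolding eventually_inf_principal using le by (intro always_eventually) blast
    qed
  qed
  moreover have "\<exists>j\<ge>i. even (Suc j)" for i
    by (cases "even i") (auto intro: exI[of _ i] exI[of _ "Suc i"])
  ultimately show ?thesis
    unfolding distributionally_near_zero_def using upper_density_half_blocks by blast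
qed

lemma unbounded: "distributionally_unbounded entire_seminorm deriv f"
proof -
  \<comment> \<open>The disc of radius 0 is a single point, so the weakest seminorm already detects
    unboundedness.\<close>
  have "entire_seminorm 0 ((deriv ^^ n) f) = b n" for n
  proof -
    have "(deriv ^^ n) f 0 = of_real (b n)"
      unfolding funpow_deriv_f using powser_zero[of "\<lambda>k. complex_of_real (b (n + k)) / fact k"] by simp
    then show ?thesis using b_nonneg[of n] by (simp add: entire_seminorm_def)
  qed
  moreover have "filterlim b at_top (inf sequentially (principal (half_blocks odd)))"
  proof -
    have "filterlim (\<lambda>n. real (level (real n))) at_top (inf sequentially (principal (half_blocks odd)))"
      by (rule filterlim_mono[OF level_at_top order_refl inf_le1])
    then show ?thesis
      by (rule filterlim_cong[THEN iffD1, rotated -1])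
         (auto simp: eventually_inf_principal half_blocks_def b_def)
  qed
  moreover have "\<exists>j\<ge>i. odd (Suc j)" for i
    by (cases "even i") (auto intro: exI[of _ i] exI[of _ "Suc i"])
  ultimately show ?thesis
    unfolding distributionally_unbounded_def using upper_density_half_blocks[of odd]
    by (intro exI[of _ 0] exI[of _ "half_blocks odd"]) auto
qed

end

lemma exists_irregular_of_growth:
  fixes p :: ereal and \<phi> :: "real \<Rightarrow> real"
  assumes p: "1 \<le> p" and \<phi>: "filterlim \<phi> at_top at_top"
  shows "\<exists>f. f holomorphic_on UNIV \<and> distributionally_irregular entire_seminorm deriv f \<and>
    (\<forall>\<^sub>F r in at_top. M_mean p f r \<le> \<phi> r * (exp r / r powr real_of_ereal (1 / (2 * max 2 p))))"
proof -
  \<comment> \<open>\<open>k + 2\<close> is \<open>level r + 1\<close> on block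
    \<open>k + 1\<close>, and 6 is the constant of \<open>M_mean_f_le\<close>. Block
    \<open>k + 1\<close> begins at \<open>N k\<close>, hence \<open>N k\<close> is made at least
    \<open>g k\<close>.\<close>
  have "\<exists>g. \<forall>r\<ge>real g. 6 * (real k + 2) \<le> \<phi> r" for k
  proof -
    have "\<forall>\<^sub>F r in at_top. 6 * (real k + 2) \<le> \<phi> r"
      using \<phi> by (simp add: filterlim_at_top)
    then obtain R where R: "\<And>r. r \<ge> R \<Longrightarrow> 6 * (real k + 2) \<le> \<phi> r"
      unfolding eventually_at_top_linorder by blast
    obtain g :: nat where "R \<le> real g" using real_arch_simple by blast
    with R show ?thesis by (intro exI[of _ g]) auto
  qed
  then obtain g :: "nat \<Rightarrow> nat" where g: "\<And>k r. r \<ge> real (g k) \<Longrightarrow> 6 * (real k + 2) \<le> \<phi> r"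
    by metis
  define N where "N = rec_nat (1 + g 0) (\<lambda>k x. 2 * (k + 2) * x + g (Suc k))"
  have N: "N 0 = 1 + g 0" "N (Suc k) = 2 * (k + 2) * N k + g (Suc k)" for k
    by (simp_all add: N_def)
  interpret block_sequence N
    by unfold_locales (simp_all add: N)
  have gN: "g k \<le> N k" for k
    by (cases k) (simp_all add: N)
  have "\<forall>\<^sub>F r in at_top. M_mean p f r \<le> \<phi> r * (exp r / r powr real_of_ereal (1 / (2 * max 2 p)))"
    using eventually_ge_at_top[of "real (N 0)"]
  proof eventually_elim
    case (elim r)
    have r: "r \<ge> 1" using elim N_0 by linarith
    \<comment> \<open>Below \<open>N 0\<close> no threshold \<open>g\<close> controls the function,
      so only radii from \<open>N 0\<close> on are considered.\<close>
    have "level r \<noteq> 0"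
      using less_N_level[of r] elim by (intro notI) simp
    then obtain k where k: "level r = Suc k" by (cases "level r") auto
    have "real (g k) \<le> real (N k)" using gN by simp
    also have "\<dots> \<le> r" by (rule N_le_of_less_level) (simp add: k)
    finally have "6 * (real (level r) + 1) \<le> \<phi> r"
      using g[of k r] by (simp add: k)
    then have "6 * (real (level r) + 1) * (exp r / r powr real_of_ereal (1 / (2 * max 2 p)))
        \<le> \<phi> r * (exp r / r powr real_of_ereal (1 / (2 * max 2 p)))"
      using r by (intro mult_right_mono) auto
    with M_mean_f_le[OF p r] show ?case by (rule order_trans)
  qed
  then show ?thesis
    using holomorphic_f near_zero unbounded unfolding distributionally_irregular_def by blast
qed

theorem theorem3p1:
  fixes p :: ereal
  assumes "1 \<le> p"
  shows "(\<forall>\<phi> :: real \<Rightarrow> real.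
            (\<forall>r>0. 0 \<le> \<phi> r) \<and> filterlim \<phi> at_top at_top \<longrightarrow>
            (\<exists>f. f holomorphic_on UNIV \<and>
                 distributionally_irregular entire_seminorm deriv f \<and>
                 (\<forall>\<^sub>F r in at_top.
                    M_mean p f r \<le> \<phi> r * (exp r / r powr real_of_ereal (1 / (2 * max 2 p))))))
       \<and> (\<nexists>f. f holomorphic_on UNIV \<and>
               distributionally_irregular entire_seminorm deriv f \<and>
               (\<exists>c>0. \<forall>\<^sub>F r in at_top.
                  M_mean p f r \<le> c * (exp r / r powr real_of_ereal (1 / (2 * min 2 p)))))"
proof (intro conjI allI impI)
  fix \<phi> :: "real \<Rightarrow> real"
  assume "(\<forall>r>0. 0 \<le> \<phi> r) \<and> filterlim \<phi> at_top at_top"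
  then show "\<exists>f. f holomorphic_on UNIV \<and> distributionally_irregular entire_seminorm deriv f \<and>
      (\<forall>\<^sub>F r in at_top. M_mean p f r \<le> \<phi> r * (exp r / r powr real_of_ereal (1 / (2 * max 2 p))))"
    using exists_irregular_of_growth[OF assms] by blast
next
  show "\<nexists>f. f holomorphic_on UNIV \<and> distributionally_irregular entire_seminorm deriv f \<and>
      (\<exists>c>0. \<forall>\<^sub>F r in at_top.
         M_mean p f r \<le> c * (exp r / r powr real_of_ereal (1 / (2 * min 2 p))))"
    using not_distributionally_unbounded[OF _ assms] unfolding distributionally_irregular_def by blast
qed

end
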